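(* Let $d\ge 1$ be an integer and $\varepsilon\in(0,1)$. Let $G$ be a finite abelian group, $A\subseteq G$, and $\delta=|A|/|G|$. (i) If $A$ is $\varepsilon$-uniform of degree $d$, i.e. $\|A-\delta\|_{U^{d+1}}\le\varepsilon$, then for every integer $k\ge d+1$ the Cayley hypergraph $\Gamma^{(k)}_A$ is $\varepsilon$-quasirandom of order $d$, i.e. $\|\Gamma^{(k)}_A-\delta\|_{\square^k_d}\le\varepsilon$. (ii) Conversely, if for some integer $k\ge d+1$ the hypergraph $\Gamma^{(k)}_A$ is $\varepsilon$-quasirandom of order $d$, then $A$ is $2\varepsilon^{c_{k,d}}$-uniform of degree $d$, i.e. $\|A-\delta\|_{U^{d+1}}\le 2\varepsilon^{c_{k,d}}$, where $c_{k,d}=2^{-(d+2)(2d+2)^k}$.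
   Context: Sets are identified with their indicator functions; $\mathbb{E}_{x\in X}$ denotes the average $|X|^{-1}\sum_{x\in X}$. For a finite abelian group $G$, an integer $m\ge 2$ and $f:G\to\mathbb{R}$, the Gowers uniformity norm is $\|f\|_{U^m}=\big(\mathbb{E}_{x,h_1,\dots,h_m\in G}\prod_{\omega\in\{0,1\}^m} f(x+\sum_{i=1}^m\omega_ih_i)\big)^{1/2^m}$. For $A\subseteq G$ with $\delta=|A|/|G|$, $A$ is called $\varepsilon$-uniform of degree $d$ if $\|A-\delta\|_{U^{d+1}}\le\varepsilon$. For integers $1\le d<k$, a finite set $V$ and $f:V^k\to\mathbb{R}$, the $d$-cut norm is $\|f\|_{\square^k_d}=\max\big|\mathbb{E}_{\mathbf{x}\in V^{k}}\big[f(\mathbf{x})\prod_{B\in\binom{[k]}{d}}S_B(\mathbf{x}_B)\big]\big|$, the maximum taken over all families of subsets $S_B\subseteq V^B$ ($B\in\binom{[k]}{d}$), where $\mathbf{x}_B=(x_j)_{j\in B}$. The Cayley $k$-graph $\Gamma^{(k)}_A$ of $A\subseteq G$ has vertex set $G$ and edge indicator function $\Gamma^{(k)}_A(x_1,\dots,x_k)=A(x_1+\dots+x_k)$ on $G^k$ (hypergraphs are allowed to have loops, i.e. edges are a symmetric subset of $V^k$); its edge density is $\delta=|A|/|G|$. A $k$-graph $H$ with edge density $\delta(H)$ is $\varepsilon$-quasirandom of order $d$ if $\|H-\delta(H)\|_{\square^k_d}\le\varepsilon$, where $H$ denotes its edge indicator function on $V(H)^k$. *)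

theory Defs
  imports "HOL-Library.FuncSet" "HOL-Library.Indicator_Function" Complex_Main
begin

definition avg :: "'b set \<Rightarrow> ('b \<Rightarrow> real) \<Rightarrow> real" where
  "avg X f = (\<Sum>x\<in>X. f x) / real (card X)"

text \<open>Gowers U^m norm on a finite abelian group (the type 'a). Tuples (h_1,...,h_m) are
  functions on {..<m}; omega in {0,1}^m is identified with the subset S of {..<m} where omega_i = 1.\<close>
definition gowers_norm :: "nat \<Rightarrow> ('a::{ab_group_add,finite} \<Rightarrow> real) \<Rightarrow> real" where
  "gowers_norm m f = root (2^m)
     (avg UNIV (\<lambda>x. avg (PiE {..<m} (\<lambda>_. UNIV))
        (\<lambda>h. \<Prod>S\<in>Pow {..<m}. f (x + (\<Sum>i\<in>S. h i)))))"

text \<open>d-cut norm of f : V^k -> R; points of V^k are functions on {..<k} (extensional),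
  x_B is the restriction of x to B, and S_B is a subset of V^B.\<close>
definition cut_norm :: "nat \<Rightarrow> nat \<Rightarrow> 'b set \<Rightarrow> ((nat \<Rightarrow> 'b) \<Rightarrow> real) \<Rightarrow> real" where
  "cut_norm k d V f = Sup {\<bar>avg (PiE {..<k} (\<lambda>_. V))
        (\<lambda>x. f x * (\<Prod>B\<in>{B. B \<subseteq> {..<k} \<and> card B = d}. indicator (S B) (restrict x B)))\<bar>
      | S. \<forall>B. S B \<subseteq> PiE B (\<lambda>_. V)}"

definition cayley_graph :: "nat \<Rightarrow> 'a::ab_group_add set \<Rightarrow> (nat \<Rightarrow> 'a) \<Rightarrow> real" where
  "cayley_graph k A = (\<lambda>x. indicator A (\<Sum>i<k. x i))"

end

theory Submission
  imports Defs "HOL-Library.Function_Algebras"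
begin

text \<open>
  Write \<open>g = A - \<delta>\<close> and consider \<open>g(x\<^sub>0 + \<dots> + x\<^sub>k\<^sub>-\<^sub>1)\<close> on \<open>G\<^sup>k\<close>. Part (i) is the Gowers--Cauchy--Schwarz
  inequality in \<open>d + 1\<close> of the coordinates: a function of \<open>d\<close> coordinates misses one of them.

  For part (ii), expanding \<open>\<parallel>g\<parallel>\<close> shows that \<open>g(x\<^sub>0 + \<dots> + x\<^sub>d)\<close> correlates with a product of bounded
  functions of \<open>d\<close> of its \<open>d + 1\<close> coordinates, and one increases the number of coordinates one at
  a time. Splitting \<open>x\<^sub>0\<close> as \<open>z + w\<close> turns the factors containing \<open>x\<^sub>0\<close> into functions \<open>v(z + w, x\<^sub>C)\<close> with
  \<open>|C| = d - 1\<close>, which depend on \<open>d + 1\<close> coordinates and are removed one by one. Replace \<open>v\<close> by the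
  average \<open>\<phi>\<close> of the remaining factors \<open>R\<close> over the coordinates that \<open>v\<close> does not see. Then
  \<open>\<langle>v, R\<rangle>\<^sup>2 \<le> \<langle>\<phi>, R\<rangle>\<close>, and Gowers--Cauchy--Schwarz bounds \<open>\<langle>\<phi>, R\<rangle>\<close> by the box norm of
  \<open>\<phi>(z + w, x\<^sub>C)\<close>, because after the substitution \<open>x\<^sub>y \<mapsto> x\<^sub>y - z\<close> for some \<open>y \<notin> C\<close> every factor of \<open>R\<close>
  misses one of \<open>z, w, x\<^sub>C\<close>. Expanding that box norm, \<open>\<phi>\<close> and hence \<open>R\<close> correlates with a product of
  functions of \<open>d\<close> of the coordinates \<open>z, w, x\<^sub>C\<close>, and \<open>v\<close> is gone.

  All functions live on one group \<open>X\<close>, and ``depends only on certain coordinates'' is expressed as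
  invariance under a subgroup of translations.
\<close>

section \<open>Averages\<close>

lemma avg_const: "finite X \<Longrightarrow> X \<noteq> {} \<Longrightarrow> avg X (\<lambda>_. c) = c"
  by (simp add: avg_def)

lemma avg_mono: "(\<And>x. x \<in> X \<Longrightarrow> f x \<le> g x) \<Longrightarrow> avg X f \<le> avg X g"
  unfolding avg_def by (intro divide_right_mono sum_mono) auto

lemma avg_cong: "(\<And>x. x \<in> X \<Longrightarrow> f x = g x) \<Longrightarrow> avg X f = avg X g"
  unfolding avg_def by (metis sum.cong)

lemma avg_swap: "avg X (\<lambda>x. avg Y (f x)) = avg Y (\<lambda>y. avg X (\<lambda>x. f x y))"
proof -
  have "(\<Sum>x\<in>X. sum (f x) Y) = (\<Sum>y\<in>Y. \<Sum>x\<in>X. f x y)"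
    by (rule sum.swap)
  thus ?thesis by (simp add: avg_def flip: sum_divide_distrib)
qed

lemma avg_mult_left: "avg X (\<lambda>x. c * f x) = c * avg X f"
  by (simp add: avg_def sum_distrib_left)

lemma avg_mult_right: "avg X (\<lambda>x. f x * c) = avg X f * c"
  by (simp add: avg_def sum_distrib_right)

lemma avg_diff: "avg X (\<lambda>x. f x - g x) = avg X f - avg X g"
  by (simp add: avg_def sum_subtractf diff_divide_distrib)

lemma avg_reindex: "bij_betw b X Y \<Longrightarrow> avg Y f = avg X (\<lambda>x. f (b x))"
  unfolding avg_def by (simp add: sum.reindex_bij_betw bij_betw_same_card)

lemma abs_avg_le: "\<bar>avg X f\<bar> \<le> avg X (\<lambda>x. \<bar>f x\<bar>)"
  unfolding avg_def by (simp add: divide_right_mono sum_abs)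

lemma abs_avg_le_1:
  assumes "\<And>x. x \<in> X \<Longrightarrow> \<bar>f x\<bar> \<le> 1"
  shows "\<bar>avg X f\<bar> \<le> 1"
proof (cases "finite X \<and> X \<noteq> {}")
  case True
  then show ?thesis
    using abs_avg_le[of X f] avg_mono[of X "\<lambda>x. \<bar>f x\<bar>" "\<lambda>_. 1"] assms
    by (simp add: avg_const)
next
  case False
  then show ?thesis by (auto simp: avg_def)
qed

lemma exists_ge_avg:
  assumes "finite X" "X \<noteq> {}"
  shows "\<exists>x\<in>X. avg X f \<le> f x"
proof (rule ccontr)
  assume "\<not> (\<exists>x\<in>X. avg X f \<le> f x)"
  hence "(\<Sum>x\<in>X. f x) < (\<Sum>x\<in>X. avg X f)"
    using assms by (intro sum_strict_mono) auto
  moreover have "card X > 0"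
    using assms by (simp add: card_gt_0_iff)
  ultimately show False by (simp add: avg_def)
qed

lemma avg_power2_le: "(avg X f)\<^sup>2 \<le> avg X (\<lambda>x. (f x)\<^sup>2)"
proof (cases "finite X \<and> X \<noteq> {}")
  case True
  define c where "c = avg X f"
  have "0 \<le> avg X (\<lambda>x. (f x - c)\<^sup>2)"
    unfolding avg_def by (simp add: sum_nonneg)
  also have "avg X (\<lambda>x. (f x - c)\<^sup>2) = avg X (\<lambda>x. (f x)\<^sup>2 - (2 * c * f x - c\<^sup>2))"
    by (intro avg_cong) (simp add: power2_diff)
  also have "\<dots> = avg X (\<lambda>x. (f x)\<^sup>2) - c\<^sup>2"
    using True by (simp add: avg_diff avg_mult_left avg_const c_def power2_eq_square)
  finally show ?thesis by (simp add: c_def)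
next
  case False
  then show ?thesis by (auto simp: avg_def)
qed

text \<open>Convexity by repeated squaring; the exponent is a power of two, so \<open>f\<close> may
  take either sign.\<close>

lemma avg_power_le: "(avg X f) ^ (2 ^ n) \<le> avg X (\<lambda>x. (f x) ^ (2 ^ n))"
proof (induction n arbitrary: f)
  case (Suc n)
  have "(avg X f) ^ (2 ^ Suc n) = ((avg X f)\<^sup>2) ^ (2 ^ n)"
    by (simp add: power_mult)
  also have "\<dots> \<le> (avg X (\<lambda>x. (f x)\<^sup>2)) ^ (2 ^ n)"
    by (intro power_mono avg_power2_le) auto
  also have "\<dots> \<le> avg X (\<lambda>x. ((f x)\<^sup>2) ^ (2 ^ n))"
    by (rule Suc.IH)
  finally show ?case by (simp add: power_mult)
qed simp


section \<open>Products of bounded invariant functions\<close>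

text \<open>\<open>K\<close> is an arbitrary set of translations, so a union such as
  \<open>K \<union> range (\<iota> i)\<close> can be used without passing to the subgroup it
  generates.\<close>

definition inv_under :: "'b::ab_group_add set \<Rightarrow> ('b \<Rightarrow> real) \<Rightarrow> bool" where
  "inv_under K u \<longleftrightarrow> (\<forall>e\<in>K. \<forall>x. u (x + e) = u x)"

lemma inv_under_mono: "K \<subseteq> K' \<Longrightarrow> inv_under K' u \<Longrightarrow> inv_under K u"
  unfolding inv_under_def by blast

text \<open>The index of a factor records which translations it ignores. Absent factors are
  \<open>1\<close> and factors with the same index can be merged, so the class is closed under
  products.\<close>

definition unit_prod ::
    "'i set \<Rightarrow> ('i \<Rightarrow> 'b::ab_group_add set) \<Rightarrow> ('b \<Rightarrow> real) \<Rightarrow> bool" where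
  "unit_prod I K U \<longleftrightarrow>
     (\<exists>u. (\<forall>i\<in>I. (\<forall>x. \<bar>u i x\<bar> \<le> 1) \<and> inv_under (K i) (u i)) \<and> U = (\<lambda>x. \<Prod>i\<in>I. u i x))"

lemma unit_prodI:
  assumes "\<And>i x. i \<in> I \<Longrightarrow> \<bar>u i x\<bar> \<le> 1" "\<And>i. i \<in> I \<Longrightarrow> inv_under (K i) (u i)"
    "\<And>x. U x = (\<Prod>i\<in>I. u i x)"
  shows "unit_prod I K U"
  unfolding unit_prod_def using assms by (intro exI[of _ u]) auto

lemma abs_mult_le_1: "\<bar>a\<bar> \<le> 1 \<Longrightarrow> \<bar>b\<bar> \<le> 1 \<Longrightarrow> \<bar>a * b :: real\<bar> \<le> 1"
  by (simp add: abs_mult mult_le_one)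

lemma unit_prod_abs_le:
  assumes "unit_prod I K U"
  shows "\<bar>U x\<bar> \<le> 1"
proof -
  obtain u where u: "\<forall>i\<in>I. (\<forall>x. \<bar>u i x\<bar> \<le> 1) \<and> inv_under (K i) (u i)"
      "U = (\<lambda>x. \<Prod>i\<in>I. u i x)"
    using assms unfolding unit_prod_def by blast
  have "(\<Prod>i\<in>I. \<bar>u i x\<bar>) \<le> 1"
    using u(1) by (intro prod_le_1) auto
  thus ?thesis by (simp add: u(2) abs_prod)
qed

lemma unit_prod_one: "unit_prod I K (\<lambda>_. 1)"
  by (rule unit_prodI[where u = "\<lambda>_ _. 1"]) (auto simp: inv_under_def)

lemma unit_prod_mult:
  assumes "unit_prod I K U" "unit_prod I K V"
  shows "unit_prod I K (\<lambda>x. U x * V x)"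
proof -
  obtain u where u: "\<forall>i\<in>I. (\<forall>x. \<bar>u i x\<bar> \<le> 1) \<and> inv_under (K i) (u i)"
      "U = (\<lambda>x. \<Prod>i\<in>I. u i x)"
    using assms(1) unfolding unit_prod_def by blast
  obtain v where v: "\<forall>i\<in>I. (\<forall>x. \<bar>v i x\<bar> \<le> 1) \<and> inv_under (K i) (v i)"
      "V = (\<lambda>x. \<Prod>i\<in>I. v i x)"
    using assms(2) unfolding unit_prod_def by blast
  show ?thesis
    by (rule unit_prodI[where u = "\<lambda>i x. u i x * v i x"])
      (use u v in \<open>auto simp: prod.distrib inv_under_def intro: abs_mult_le_1\<close>)
qed

lemma unit_prod_single:
  assumes "finite I" "i \<in> I" "\<And>x. \<bar>u x\<bar> \<le> 1" "inv_under (K i) u"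
  shows "unit_prod I K u"
proof (rule unit_prodI[where u = "\<lambda>j. if j = i then u else (\<lambda>_. 1)"])
  show "u x = (\<Prod>j\<in>I. (if j = i then u else (\<lambda>_. 1)) x)" for x
    using assms(1,2) by (simp add: if_distrib[of "\<lambda>f. f x"])
qed (use assms in \<open>auto simp: inv_under_def\<close>)

lemma unit_prod_shift:
  assumes "unit_prod I K U"
  shows "unit_prod I K (\<lambda>x. U (x + e))"
proof -
  obtain u where u: "\<forall>i\<in>I. (\<forall>x. \<bar>u i x\<bar> \<le> 1) \<and> inv_under (K i) (u i)"
      "U = (\<lambda>x. \<Prod>i\<in>I. u i x)"
    using assms(1) unfolding unit_prod_def by blast
  have "inv_under (K i) (\<lambda>x. u i (x + e))" if "i \<in> I" for i
    using u(1) that unfolding inv_under_def by (metis add.assoc add.commute)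
  thus ?thesis
    by (intro unit_prodI[where u = "\<lambda>i x. u i (x + e)"]) (use u in auto)
qed

lemma unit_prod_insertE:
  assumes "unit_prod (insert i I) K U" "finite I" "i \<notin> I"
  obtains u V where "\<And>x. \<bar>u x\<bar> \<le> 1" "inv_under (K i) u" "unit_prod I K V"
    "U = (\<lambda>x. u x * V x)"
proof -
  obtain u where u: "\<forall>j\<in>insert i I. (\<forall>x. \<bar>u j x\<bar> \<le> 1) \<and> inv_under (K j) (u j)"
      "U = (\<lambda>x. \<Prod>j\<in>insert i I. u j x)"
    using assms(1) unfolding unit_prod_def by blast
  have "unit_prod I K (\<lambda>x. \<Prod>j\<in>I. u j x)"
    using u(1) by (intro unit_prodI[where u = u]) auto
  thus ?thesis
    using u assms(2,3) by (intro that[of "u i" "\<lambda>x. \<Prod>j\<in>I. u j x"]) auto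
qed

lemma unit_prod_Un:
  assumes "unit_prod (I \<union> J) K U" "finite I" "finite J" "I \<inter> J = {}"
  obtains V W where "unit_prod I K V" "unit_prod J K W" "U = (\<lambda>x. V x * W x)"
proof -
  obtain u where u: "\<forall>j\<in>I \<union> J. (\<forall>x. \<bar>u j x\<bar> \<le> 1) \<and> inv_under (K j) (u j)"
      "U = (\<lambda>x. \<Prod>j\<in>I \<union> J. u j x)"
    using assms(1) unfolding unit_prod_def by blast
  show ?thesis
  proof (rule that)
    show "unit_prod I K (\<lambda>x. \<Prod>j\<in>I. u j x)" "unit_prod J K (\<lambda>x. \<Prod>j\<in>J. u j x)"
      using u(1) by (auto intro!: unit_prodI[where u = u])
    show "U = (\<lambda>x. (\<Prod>j\<in>I. u j x) * (\<Prod>j\<in>J. u j x))"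
      using u(2) assms by (simp add: prod.union_disjoint)
  qed
qed

lemma unit_prod_transfer:
  assumes "finite I" "finite J" "unit_prod I K U"
    "\<And>i. i \<in> I \<Longrightarrow> \<exists>j\<in>J. K' j \<subseteq> K i"
  shows "unit_prod J K' U"
  using assms
proof (induction I arbitrary: U rule: finite_induct)
  case empty
  hence "U = (\<lambda>_. 1)" by (auto simp: unit_prod_def)
  then show ?case using unit_prod_one by metis
next
  case (insert i I)
  obtain u V where uV: "\<And>x. \<bar>u x\<bar> \<le> 1" "inv_under (K i) u" "unit_prod I K V"
    "U = (\<lambda>x. u x * V x)"
    using unit_prod_insertE[OF insert.prems(2) insert.hyps] by blast
  obtain j where j: "j \<in> J" "K' j \<subseteq> K i"
    using insert.prems(3) by blast
  have "unit_prod J K' u"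
    using uV j insert.prems(1) by (intro unit_prod_single[of J j]) (auto intro: inv_under_mono)
  moreover have "unit_prod J K' V"
    using insert.IH insert.prems uV(3) by simp
  ultimately show ?case
    unfolding uV(4) by (rule unit_prod_mult)
qed


section \<open>Box averages in a finite group\<close>

text \<open>A set rather than a type, because the tuples of length \<open>k\<close> will form a
  finite subgroup of the function type \<open>nat \<Rightarrow> 'a\<close>.\<close>

definition subgrp :: "'b::ab_group_add set \<Rightarrow> bool" where
  "subgrp X \<longleftrightarrow> finite X \<and> 0 \<in> X \<and> (\<forall>x\<in>X. \<forall>y\<in>X. x + y \<in> X) \<and> (\<forall>x\<in>X. - x \<in> X)"

lemma subgrp_UNIV: "subgrp (UNIV :: 'a::{ab_group_add,finite} set)"
  by (simp add: subgrp_def)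

lemma bij_betw_subgrp_shift:
  assumes "subgrp X" "e \<in> X"
  shows "bij_betw (\<lambda>x. x + e) X X"
proof (rule bij_betwI[where g = "\<lambda>x. x + - e"])
  show "(\<lambda>x. x + e) \<in> X \<rightarrow> X" "(\<lambda>x. x + - e) \<in> X \<rightarrow> X"
    using assms unfolding subgrp_def by blast+
qed auto

lemma avg_shift:
  assumes "subgrp X" "e \<in> X"
  shows "avg X (\<lambda>x. f (x + e)) = avg X f"
  using avg_reindex[OF bij_betw_subgrp_shift[OF assms], of f] by simp

lemma avg_uminus:
  assumes "subgrp X"
  shows "avg X (\<lambda>x. f (- x)) = avg X f"
proof -
  have "bij_betw uminus X X"
    using assms by (intro bij_betwI[where g = uminus]) (auto simp: subgrp_def)
  from avg_reindex[OF this, of f] show ?thesis by simp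
qed

text \<open>A box norm before the root is taken: \<open>F\<close> is multiplied over the vertices of
  a parallelepiped with one edge along each listed direction. Unfolding one direction at a time
  matches the inductions below.\<close>

fun box :: "'b::ab_group_add set \<Rightarrow> ('i \<Rightarrow> 'a \<Rightarrow> 'b) \<Rightarrow> 'i list \<Rightarrow> ('b \<Rightarrow> real) \<Rightarrow> real" where
  "box X \<iota> [] F = avg X F"
| "box X \<iota> (i # is) F = avg UNIV (\<lambda>a. box X \<iota> is (\<lambda>x. F x * F (x + \<iota> i a)))"

lemma box_cong_dirs:
  assumes "\<And>i x a. i \<in> set is \<Longrightarrow> F (x + \<iota> i a) = F (x + \<iota>' i a)"
  shows "box X \<iota> is F = box X \<iota>' is F"
  using assms
proof (induction "is" arbitrary: F)
  case (Cons i "is")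
  have "F (x + \<iota> j b + \<iota> i a) = F (x + \<iota>' j b + \<iota> i a)" if "j \<in> set is" for x j a b
  proof -
    have "F (x + \<iota> i a + \<iota> j b) = F (x + \<iota> i a + \<iota>' j b)"
      using Cons.prems that by simp
    thus ?thesis by (simp add: ac_simps)
  qed
  hence "box X \<iota> is (\<lambda>x. F x * F (x + \<iota> i a)) = box X \<iota>' is (\<lambda>x. F x * F (x + \<iota> i a))" for a
    using Cons.prems by (intro Cons.IH) simp
  moreover have "F (x + \<iota> i a) = F (x + \<iota>' i a)" for x a
    using Cons.prems by simp
  ultimately show ?case by simp
qed simp

text \<open>A single Cauchy--Schwarz step: \<open>u\<close> is constant along
  \<open>\<iota>\<close>, so \<open>Q\<close> may first be averaged along \<open>\<iota>\<close>,
  and then \<open>u\<close> is discarded.\<close>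

lemma avg_inv_mult_power2_le:
  fixes \<iota> :: "'a::{ab_group_add,finite} \<Rightarrow> 'b::ab_group_add"
  assumes X: "subgrp X" and u: "\<And>x. \<bar>u x\<bar> \<le> 1" "inv_under (range \<iota>) u"
    and \<iota>: "\<And>a. \<iota> a \<in> X" "\<And>a b. \<iota> (a + b) = \<iota> a + \<iota> b"
  shows "(avg X (\<lambda>x. u x * Q x))\<^sup>2 \<le> avg UNIV (\<lambda>a. avg X (\<lambda>x. Q x * Q (x + \<iota> a)))"
proof -
  define P where "P = (\<lambda>x. avg UNIV (\<lambda>a. Q (x + \<iota> a)))"
  have "avg X (\<lambda>x. u x * Q x) = avg UNIV (\<lambda>a. avg X (\<lambda>x. u (x + \<iota> a) * Q (x + \<iota> a)))"
    using avg_shift[OF X \<iota>(1), of "\<lambda>x. u x * Q x"] by (simp add: avg_const)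
  also have "\<dots> = avg UNIV (\<lambda>a. avg X (\<lambda>x. u x * Q (x + \<iota> a)))"
    using u(2) by (simp add: inv_under_def)
  also have "\<dots> = avg X (\<lambda>x. u x * P x)"
    unfolding P_def by (subst avg_swap) (simp add: avg_mult_left)
  finally have "(avg X (\<lambda>x. u x * Q x))\<^sup>2 \<le> avg X (\<lambda>x. (u x * P x)\<^sup>2)"
    using avg_power2_le by metis
  also have "\<dots> \<le> avg X (\<lambda>x. (P x)\<^sup>2)"
  proof (rule avg_mono)
    fix x
    have "(u x)\<^sup>2 \<le> 1" using u(1) by (simp add: abs_square_le_1)
    thus "(u x * P x)\<^sup>2 \<le> (P x)\<^sup>2"
      by (simp add: power_mult_distrib mult_left_le_one_le)
  qed
  also have "\<dots> = avg X (\<lambda>x. avg UNIV (\<lambda>b. avg UNIV (\<lambda>a. Q (x + \<iota> a) * Q (x + \<iota> b))))"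
    unfolding P_def power2_eq_square by (simp add: avg_mult_left avg_mult_right)
  also have "\<dots> = avg UNIV (\<lambda>b. avg UNIV (\<lambda>a. avg X (\<lambda>x. Q (x + \<iota> a) * Q (x + \<iota> b))))"
    by (subst avg_swap, subst avg_swap) (rule refl)
  \<comment> \<open>Substituting \<open>a + b\<close> for \<open>a\<close> turns two independent
    shifts into a base point and a difference; the base shift \<open>\<iota> b\<close> is then
    absorbed by the average over \<open>X\<close>.\<close>
  also have "\<dots> = avg UNIV (\<lambda>b. avg UNIV (\<lambda>a. avg X (\<lambda>x. Q (x + \<iota> b) * Q (x + \<iota> b + \<iota> a))))"
  proof (rule avg_cong)
    fix b
    have "avg UNIV (\<lambda>a. avg X (\<lambda>x. Q (x + \<iota> a) * Q (x + \<iota> b))) =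
          avg UNIV (\<lambda>a. avg X (\<lambda>x. Q (x + \<iota> (a + b)) * Q (x + \<iota> b)))"
      using avg_shift[OF subgrp_UNIV, of b "\<lambda>a. avg X (\<lambda>x. Q (x + \<iota> a) * Q (x + \<iota> b))"]
      by simp
    thus "avg UNIV (\<lambda>a. avg X (\<lambda>x. Q (x + \<iota> a) * Q (x + \<iota> b))) =
          avg UNIV (\<lambda>a. avg X (\<lambda>x. Q (x + \<iota> b) * Q (x + \<iota> b + \<iota> a)))"
      by (simp add: \<iota>(2) ac_simps)
  qed
  also have "\<dots> = avg UNIV (\<lambda>b::'a. avg UNIV (\<lambda>a. avg X (\<lambda>x. Q x * Q (x + \<iota> a))))"
    using avg_shift[OF X \<iota>(1), of "\<lambda>x. Q x * Q (x + \<iota> _)"] by simp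
  finally show ?thesis by (simp add: avg_const)
qed

text \<open>Each direction costs one squaring and removes the factor that ignores it; the others
  become \<open>V x * V (x + \<iota> i a)\<close> and keep their invariance.
  \<open>avg_power_le\<close> moves the remaining power inside the average over
  \<open>a\<close>.\<close>

lemma gowers_cauchy_schwarz:
  fixes \<iota> :: "'i \<Rightarrow> 'a::{ab_group_add,finite} \<Rightarrow> 'b::ab_group_add"
  assumes "subgrp X" "distinct is" "unit_prod (set is) (\<lambda>i. range (\<iota> i)) U"
    and "\<And>i a. i \<in> set is \<Longrightarrow> \<iota> i a \<in> X"
    and "\<And>i a b. i \<in> set is \<Longrightarrow> \<iota> i (a + b) = \<iota> i a + \<iota> i b"
  shows "(avg X (\<lambda>x. F x * U x)) ^ (2 ^ length is) \<le> box X \<iota> is F"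
  using assms
proof (induction "is" arbitrary: F U)
  case Nil
  then show ?case by (simp add: unit_prod_def)
next
  case (Cons i "is")
  obtain u V where uV: "\<And>x. \<bar>u x\<bar> \<le> 1" "inv_under (range (\<iota> i)) u"
    "unit_prod (set is) (\<lambda>i. range (\<iota> i)) V" "U = (\<lambda>x. u x * V x)"
    using Cons.prems by (auto elim!: unit_prod_insertE)
  define Q where "Q = (\<lambda>x. F x * V x)"
  have "(avg X (\<lambda>x. F x * U x)) ^ (2 ^ length (i # is))
      = ((avg X (\<lambda>x. u x * Q x))\<^sup>2) ^ (2 ^ length is)"
    by (simp add: power_mult uV(4) Q_def ac_simps)
  also have "\<dots> \<le> (avg UNIV (\<lambda>a. avg X (\<lambda>x. Q x * Q (x + \<iota> i a)))) ^ (2 ^ length is)"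
    using Cons.prems uV by (intro power_mono avg_inv_mult_power2_le) auto
  also have "\<dots> \<le> avg UNIV (\<lambda>a. (avg X (\<lambda>x. Q x * Q (x + \<iota> i a))) ^ (2 ^ length is))"
    by (rule avg_power_le)
  also have "\<dots> \<le> avg UNIV (\<lambda>a. box X \<iota> is (\<lambda>x. F x * F (x + \<iota> i a)))"
  proof (rule avg_mono)
    fix a
    have "(avg X (\<lambda>x. (F x * F (x + \<iota> i a)) * (V x * V (x + \<iota> i a)))) ^ (2 ^ length is)
        \<le> box X \<iota> is (\<lambda>x. F x * F (x + \<iota> i a))"
      using Cons.prems uV(3) by (intro Cons.IH unit_prod_mult unit_prod_shift) auto
    thus "(avg X (\<lambda>x. Q x * Q (x + \<iota> i a))) ^ (2 ^ length is)
        \<le> box X \<iota> is (\<lambda>x. F x * F (x + \<iota> i a))"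
      by (simp add: Q_def ac_simps)
  qed
  finally show ?case by simp
qed

text \<open>A partial converse of \<open>gowers_cauchy_schwarz\<close>: in the expanded box average
  the copy of \<open>F\<close> at the base vertex is kept and the others are collected into
  \<open>U\<close>. The maps \<open>p i\<close> are coordinates dual to the directions
  \<open>\<iota> i\<close>; neither they nor \<open>F\<close> notice translations in
  \<open>K\<close>.\<close>

lemma box_le_correlation:
  fixes \<iota> :: "'i \<Rightarrow> 'a::{ab_group_add,finite} \<Rightarrow> 'b::ab_group_add"
  assumes X: "subgrp X" and "distinct is" and "\<And>x. \<bar>F x\<bar> \<le> 1" and "inv_under K F"
    and "\<And>i a b. i \<in> set is \<Longrightarrow> \<iota> i (a + b) = \<iota> i a + \<iota> i b"
    and "\<And>i a x. i \<in> set is \<Longrightarrow> p i (x + \<iota> i a) = p i x + a"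
    and "\<And>i j a x. i \<in> set is \<Longrightarrow> j \<in> set is \<Longrightarrow> i \<noteq> j \<Longrightarrow> p i (x + \<iota> j a) = p i x"
    and "\<And>i e x. i \<in> set is \<Longrightarrow> e \<in> K \<Longrightarrow> p i (x + e) = p i x"
  shows "\<exists>U. unit_prod (set is) (\<lambda>i. K \<union> range (\<iota> i)) U \<and> box X \<iota> is F \<le> avg X (\<lambda>x. F x * U x)"
  using assms(2-)
proof (induction "is" arbitrary: F)
  case Nil
  show ?case by (intro exI[of _ "\<lambda>_. 1"]) (simp add: unit_prod_one)
next
  case (Cons i "is")
  note F = Cons.prems(2,3) and add = Cons.prems(4)[OF list.set_intros(1)]
    and pi = Cons.prems(5)[OF list.set_intros(1)]
  have "\<exists>U. unit_prod (set is) (\<lambda>i. K \<union> range (\<iota> i)) U \<and>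
      box X \<iota> is (\<lambda>x. F x * F (x + \<iota> i a)) \<le> avg X (\<lambda>x. (F x * F (x + \<iota> i a)) * U x)" for a
  proof (rule Cons.IH)
    show "inv_under K (\<lambda>x. F x * F (x + \<iota> i a))"
      using F(2) unfolding inv_under_def by (metis add.assoc add.commute)
  qed (use Cons.prems in \<open>auto intro!: abs_mult_le_1\<close>)
  hence "\<forall>a. \<exists>U. unit_prod (set is) (\<lambda>i. K \<union> range (\<iota> i)) U \<and>
      box X \<iota> is (\<lambda>x. F x * F (x + \<iota> i a)) \<le> avg X (\<lambda>x. (F x * F (x + \<iota> i a)) * U x)"
    by (rule allI)
  from choice[OF this] obtain U where
    U: "\<And>a. unit_prod (set is) (\<lambda>i. K \<union> range (\<iota> i)) (U a)"
    "\<And>a. box X \<iota> is (\<lambda>x. F x * F (x + \<iota> i a)) \<le> avg X (\<lambda>x. (F x * F (x + \<iota> i a)) * U a x)"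
    by blast
  hence "\<forall>a. \<exists>u. (\<forall>j\<in>set is. (\<forall>x. \<bar>u j x\<bar> \<le> 1) \<and>
      inv_under (K \<union> range (\<iota> j)) (u j)) \<and> U a = (\<lambda>x. \<Prod>j\<in>set is. u j x)"
    unfolding unit_prod_def by (intro allI)
  from choice[OF this] obtain u where
    u: "\<And>a j x. j \<in> set is \<Longrightarrow> \<bar>u a j x\<bar> \<le> 1"
    "\<And>a j. j \<in> set is \<Longrightarrow> inv_under (K \<union> range (\<iota> j)) (u a j)"
    "\<And>a. U a = (\<lambda>x. \<Prod>j\<in>set is. u a j x)"
    by blast
  \<comment> \<open>Replacing \<open>a\<close> by \<open>a - p i x\<close> freezes the coordinate
    \<open>p i\<close> of the shifted point at \<open>a\<close>, so the shifted copy of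
    \<open>F\<close> ignores moves along \<open>\<iota> i\<close>. The new dependence of
    \<open>U\<close> on \<open>x\<close> is through \<open>p i x\<close> only, which the other
    directions and \<open>K\<close> preserve.\<close>
  define W where "W = (\<lambda>a x. F (x + \<iota> i (a - p i x)) * U (a - p i x) x)"
  have "box X \<iota> (i # is) F \<le> avg UNIV (\<lambda>a. avg X (\<lambda>x. (F x * F (x + \<iota> i a)) * U a x))"
    using U(2) by (auto intro: avg_mono)
  also have "\<dots> = avg X (\<lambda>x. avg UNIV (\<lambda>a. (F x * F (x + \<iota> i a)) * U a x))"
    by (rule avg_swap)
  also have "\<dots> = avg X (\<lambda>x. avg UNIV (\<lambda>a. F x * W a x))"
  proof (rule avg_cong)
    fix x
    show "avg UNIV (\<lambda>a. (F x * F (x + \<iota> i a)) * U a x) = avg UNIV (\<lambda>a. F x * W a x)"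
      using avg_shift[OF subgrp_UNIV, of "- p i x" "\<lambda>a. (F x * F (x + \<iota> i a)) * U a x"]
      by (simp add: W_def mult.assoc)
  qed
  also have "\<dots> = avg UNIV (\<lambda>a. avg X (\<lambda>x. F x * W a x))"
    by (rule avg_swap)
  finally obtain a where a: "box X \<iota> (i # is) F \<le> avg X (\<lambda>x. F x * W a x)"
    using exists_ge_avg[of "UNIV :: 'a set" "\<lambda>a. avg X (\<lambda>x. F x * W a x)"]
    by (meson UNIV_not_empty finite order_trans)
  have "unit_prod (set (i # is)) (\<lambda>i. K \<union> range (\<iota> i)) (W a)"
  proof (rule unit_prodI[where
      u = "\<lambda>j x. if j = i then F (x + \<iota> i (a - p i x)) else u (a - p i x) j x"])
    fix j assume j: "j \<in> set (i # is)"
    show "\<bar>if j = i then F (x + \<iota> i (a - p i x)) else u (a - p i x) j x\<bar> \<le> 1" for x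
      using j F(1) u(1) by auto
    show "inv_under (K \<union> range (\<iota> j))
        (\<lambda>x. if j = i then F (x + \<iota> i (a - p i x)) else u (a - p i x) j x)"
    proof (cases "j = i")
      case True
      have "F (x + e + \<iota> i (a - p i (x + e))) = F (x + \<iota> i (a - p i x))" if "e \<in> K" for x e
      proof -
        have "F (x + \<iota> i (a - p i x) + e) = F (x + \<iota> i (a - p i x))"
          using F(2) that by (simp add: inv_under_def)
        thus ?thesis
          using Cons.prems(7)[of i e x] that by (simp add: ac_simps)
      qed
      moreover have "F (x + \<iota> i b + \<iota> i (a - p i (x + \<iota> i b))) = F (x + \<iota> i (a - p i x))" for x b
        using add[of b "a - p i (x + \<iota> i b)"] by (simp add: pi add.assoc algebra_simps)
      ultimately show ?thesis
        using True by (auto simp: inv_under_def)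
    next
      case False
      have "p i (x + e) = p i x" if "e \<in> K \<union> range (\<iota> j)" for x e
        using that j False Cons.prems(6)[of i j] Cons.prems(7)[of i e] by auto
      thus ?thesis
        using u(2)[of j] j False unfolding inv_under_def by auto
    qed
  next
    fix x
    have "i \<notin> set is" using Cons.prems(1) by simp
    hence "(\<Prod>j\<in>set is. if j = i then F (x + \<iota> i (a - p i x)) else u (a - p i x) j x)
      = (\<Prod>j\<in>set is. u (a - p i x) j x)"
      by (intro prod.cong) auto
    thus "W a x = (\<Prod>j\<in>set (i # is). if j = i then F (x + \<iota> i (a - p i x)) else u (a - p i x) j x)"
      using \<open>i \<notin> set is\<close> by (simp add: W_def u(3))
  qed
  with a show ?case by blast
qed

text \<open>\<open>\<phi>\<close> is the projection of \<open>R\<close> onto the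
  \<open>L\<close>-invariant functions, among which is \<open>v\<close>. The directions
  \<open>\<iota>\<close> are those ignored by the factors of \<open>R\<close>, while
  \<open>\<iota>'\<close> are dual to the coordinates \<open>p\<close>; they agree modulo
  \<open>L\<close>, so \<open>\<phi>\<close> does not distinguish them. The exponent counts one
  squaring for \<open>v\<close> and one per direction.\<close>

lemma remove_factor:
  fixes \<iota> \<iota>' :: "'i \<Rightarrow> 'a::{ab_group_add,finite} \<Rightarrow> 'b::ab_group_add"
  assumes X: "subgrp X" and L: "subgrp L" "L \<subseteq> X" and "K \<subseteq> L"
    and v: "\<And>x. \<bar>v x\<bar> \<le> 1" "inv_under L v"
    and dist: "distinct is" and R: "unit_prod (set is) (\<lambda>i. range (\<iota> i)) R"
    and \<iota>: "\<And>i a. i \<in> set is \<Longrightarrow> \<iota> i a \<in> X"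
      "\<And>i a b. i \<in> set is \<Longrightarrow> \<iota> i (a + b) = \<iota> i a + \<iota> i b"
    and \<iota>': "\<And>i a b. i \<in> set is \<Longrightarrow> \<iota>' i (a + b) = \<iota>' i a + \<iota>' i b"
      "\<And>i a. i \<in> set is \<Longrightarrow> \<iota> i a - \<iota>' i a \<in> L"
    and p: "\<And>i a x. i \<in> set is \<Longrightarrow> p i (x + \<iota>' i a) = p i x + a"
      "\<And>i j a x. i \<in> set is \<Longrightarrow> j \<in> set is \<Longrightarrow> i \<noteq> j \<Longrightarrow> p i (x + \<iota>' j a) = p i x"
      "\<And>i e x. i \<in> set is \<Longrightarrow> e \<in> K \<Longrightarrow> p i (x + e) = p i x"
  shows "\<exists>U. unit_prod (set is) (\<lambda>i. K \<union> range (\<iota>' i)) U \<and>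
      (avg X (\<lambda>x. v x * R x)) ^ (2 ^ Suc (length is)) \<le> avg X (\<lambda>x. R x * U x)"
proof -
  have L0: "finite L" "L \<noteq> {}" using L(1) by (auto simp: subgrp_def)
  define \<phi> where "\<phi> = (\<lambda>x. avg L (\<lambda>e. R (x + e)))"
  have \<phi>_bd: "\<bar>\<phi> x\<bar> \<le> 1" for x
    unfolding \<phi>_def using unit_prod_abs_le[OF R] by (intro abs_avg_le_1) auto
  have \<phi>_inv: "inv_under L \<phi>"
    unfolding inv_under_def \<phi>_def
  proof (intro ballI allI)
    fix e x assume "e \<in> L"
    thus "avg L (\<lambda>e'. R (x + e + e')) = avg L (\<lambda>e. R (x + e))"
      using avg_shift[OF L(1), of e "\<lambda>e'. R (x + e')"] by (simp add: ac_simps)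
  qed
  \<comment> \<open>Averaging over \<open>L\<close> is self-adjoint: a translation by
    \<open>e\<close> moves onto \<open>w\<close> as \<open>- e\<close>, and \<open>L\<close> is
    closed under negation.\<close>
  have pair: "avg X (\<lambda>x. \<phi> x * w x) = avg L (\<lambda>e. avg X (\<lambda>x. R x * w (x + e)))" for w
  proof -
    have "avg X (\<lambda>x. \<phi> x * w x) = avg L (\<lambda>e. avg X (\<lambda>x. R (x + e) * w x))"
      unfolding \<phi>_def by (subst avg_swap) (simp add: avg_mult_right)
    also have "\<dots> = avg L (\<lambda>e. avg X (\<lambda>x. R x * w (x + - e)))"
    proof (rule avg_cong)
      fix e assume "e \<in> L"
      thus "avg X (\<lambda>x. R (x + e) * w x) = avg X (\<lambda>x. R x * w (x + - e))"
        using avg_shift[OF X, of e "\<lambda>x. R x * w (x + - e)"] L(2) by auto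
    qed
    also have "\<dots> = avg L (\<lambda>e. avg X (\<lambda>x. R x * w (x + e)))"
      by (rule avg_uminus[OF L(1)])
    finally show ?thesis .
  qed
  have pair_inv: "avg X (\<lambda>x. \<phi> x * w x) = avg X (\<lambda>x. R x * w x)" if "inv_under L w" for w
  proof -
    have "avg X (\<lambda>x. \<phi> x * w x) = avg L (\<lambda>_. avg X (\<lambda>x. R x * w x))"
      unfolding pair using that by (intro avg_cong) (auto simp: inv_under_def)
    thus ?thesis using L0 by (simp add: avg_const)
  qed
  have "(avg X (\<lambda>x. v x * R x))\<^sup>2 = (avg X (\<lambda>x. \<phi> x * v x))\<^sup>2"
    by (simp add: pair_inv[OF v(2)] mult.commute)
  also have "\<dots> \<le> avg X (\<lambda>x. (\<phi> x * v x)\<^sup>2)"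
    by (rule avg_power2_le)
  also have "\<dots> \<le> avg X (\<lambda>x. \<phi> x * \<phi> x)"
  proof (rule avg_mono)
    fix x
    have "(v x)\<^sup>2 \<le> 1" using v(1) by (simp add: abs_square_le_1)
    hence "(\<phi> x)\<^sup>2 * (v x)\<^sup>2 \<le> (\<phi> x)\<^sup>2" by (simp add: mult_left_le)
    thus "(\<phi> x * v x)\<^sup>2 \<le> \<phi> x * \<phi> x"
      by (simp add: power_mult_distrib flip: power2_eq_square)
  qed
  also have "\<dots> = avg X (\<lambda>x. \<phi> x * R x)"
    by (simp add: pair_inv[OF \<phi>_inv] mult.commute)
  finally have 1: "(avg X (\<lambda>x. v x * R x))\<^sup>2 \<le> avg X (\<lambda>x. \<phi> x * R x)" .
  have "(avg X (\<lambda>x. v x * R x)) ^ (2 ^ Suc (length is))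
      = ((avg X (\<lambda>x. v x * R x))\<^sup>2) ^ (2 ^ length is)"
    by (simp add: power_mult)
  also have "\<dots> \<le> (avg X (\<lambda>x. \<phi> x * R x)) ^ (2 ^ length is)"
    using 1 by (intro power_mono) auto
  also have "\<dots> \<le> box X \<iota> is \<phi>"
    using \<iota> by (intro gowers_cauchy_schwarz X dist R)
  also have "\<dots> = box X \<iota>' is \<phi>"
  proof (rule box_cong_dirs)
    fix i x a assume "i \<in> set is"
    hence "\<phi> (x + \<iota>' i a + (\<iota> i a - \<iota>' i a)) = \<phi> (x + \<iota>' i a)"
      using \<phi>_inv \<iota>'(2) by (simp only: inv_under_def)
    thus "\<phi> (x + \<iota> i a) = \<phi> (x + \<iota>' i a)" by simp
  qed
  also obtain U where U: "unit_prod (set is) (\<lambda>i. K \<union> range (\<iota>' i)) U"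
      and "box X \<iota>' is \<phi> \<le> avg X (\<lambda>x. \<phi> x * U x)"
    using box_le_correlation[where \<iota> = \<iota>' and p = p,
        OF X dist \<phi>_bd inv_under_mono[OF \<open>K \<subseteq> L\<close> \<phi>_inv] \<iota>'(1) p] by blast
  note this(2)
  also obtain e where "avg X (\<lambda>x. \<phi> x * U x) \<le> avg X (\<lambda>x. R x * U (x + e))"
    unfolding pair using exists_ge_avg[OF L0] by blast
  note this
  finally show ?thesis using unit_prod_shift[OF U] by blast
qed


section \<open>Tuples and linear coordinates\<close>

text \<open>Zero outside \<open>{..<k}\<close>, unlike the extensional functions in
  \<open>cut_norm\<close>, so that pointwise addition gives a subgroup.\<close>

definition tuples :: "nat \<Rightarrow> (nat \<Rightarrow> 'a::ab_group_add) set" where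
  "tuples k = {x. \<forall>i\<ge>k. x i = 0}"

definition axis :: "nat \<Rightarrow> 'a::ab_group_add \<Rightarrow> nat \<Rightarrow> 'a" where
  "axis i a = (\<lambda>j. if j = i then a else 0)"

text \<open>For \<open>1 \<le> m \<le> k\<close>, the quantities \<open>lcoord m k i x\<close> with \<open>i < m\<close> are
  \<open>x\<^sub>0 + x\<^sub>m + \<dots> + x\<^sub>k\<^sub>-\<^sub>1, x\<^sub>1, \<dots>, x\<^sub>m\<^sub>-\<^sub>1\<close>, whose total is the full coordinate sum.
  A function of those with index in \<open>B\<close> is one invariant under \<open>lker m k B\<close>.\<close>

definition lcoord :: "nat \<Rightarrow> nat \<Rightarrow> nat \<Rightarrow> (nat \<Rightarrow> 'a::ab_group_add) \<Rightarrow> 'a" where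
  "lcoord m k i x = (if i = 0 then x 0 + (\<Sum>j=m..<k. x j) else x i)"

definition lker :: "nat \<Rightarrow> nat \<Rightarrow> nat set \<Rightarrow> (nat \<Rightarrow> 'a::ab_group_add) set" where
  "lker m k B = {e \<in> tuples k. \<forall>i\<in>B. lcoord m k i e = 0}"

definition dsets :: "nat \<Rightarrow> nat \<Rightarrow> nat set set" where
  "dsets m d = {B. B \<subseteq> {..<m} \<and> card B = d}"

lemma finite_dsets: "finite (dsets m d)"
  by (rule finite_subset[of _ "Pow {..<m}"]) (auto simp: dsets_def)

lemma card_dsets_le: "card (dsets m d) \<le> 2 ^ m"
  using card_mono[of "Pow {..<m}" "dsets m d"] by (auto simp: dsets_def card_Pow)

lemma bij_betw_tuples:
  "bij_betw (\<lambda>x. restrict x {..<k}) (tuples k) (PiE {..<k} (\<lambda>_. UNIV :: 'a::ab_group_add set))"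
  by (rule bij_betwI[where g = "\<lambda>y i. if i < k then y i else 0"])
    (auto simp: tuples_def fun_eq_iff PiE_def extensional_def)

lemma avg_tuples:
  fixes F :: "(nat \<Rightarrow> 'a::ab_group_add) \<Rightarrow> real"
  shows "avg (PiE {..<k} (\<lambda>_. UNIV)) F = avg (tuples k) (\<lambda>x. F (restrict x {..<k}))"
  by (rule avg_reindex[OF bij_betw_tuples])

lemma subgrp_tuples: "subgrp (tuples k :: (nat \<Rightarrow> 'a::{ab_group_add,finite}) set)"
proof -
  have "finite (PiE {..<k} (\<lambda>_. UNIV :: 'a set))"
    by (rule finite_PiE) auto
  hence "finite (tuples k :: (nat \<Rightarrow> 'a) set)"
    using bij_betw_finite[OF bij_betw_tuples] by blast
  thus ?thesis by (auto simp: subgrp_def tuples_def)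
qed

lemma axis_add: "axis i (a + b) = axis i a + axis i b"
  by (auto simp: axis_def)

lemma axis_in_tuples: "i < k \<Longrightarrow> axis i a \<in> tuples k"
  by (auto simp: axis_def tuples_def)

lemma lcoord_add: "lcoord m k i (x + y) = lcoord m k i x + lcoord m k i y"
  by (simp add: lcoord_def sum.distrib ac_simps)

lemma lcoord_uminus: "lcoord m k i (- x) = - lcoord m k i x"
  by (simp add: lcoord_def sum_negf)

lemma lcoord_zero: "lcoord m k i 0 = 0"
  by (simp add: lcoord_def)

lemma lcoord_axis: "i < m \<Longrightarrow> j < m \<Longrightarrow> lcoord m k i (axis j a) = (if i = j then a else 0)"
  by (auto simp: lcoord_def axis_def)

lemma lcoord_same: "lcoord k k i x = x i"
  by (simp add: lcoord_def)

text \<open>Passing from \<open>m\<close> to \<open>Suc m\<close> splits the merged coordinate as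
  \<open>z + w\<close> and leaves the others alone.\<close>

lemma lcoord_Suc:
  assumes "m < k"
  shows "0 < m \<Longrightarrow> lcoord m k 0 x = lcoord (Suc m) k 0 x + lcoord (Suc m) k m x"
    and "i \<noteq> 0 \<Longrightarrow> lcoord (Suc m) k i x = lcoord m k i x"
  using assms by (auto simp: lcoord_def sum.atLeast_Suc_lessThan ac_simps)

lemma sum_eq_lcoord:
  assumes "0 < m" "m \<le> k"
  shows "(\<Sum>i<k. x i) = (\<Sum>i<m. lcoord m k i x)"
proof -
  have "(\<Sum>i<m. lcoord m k i x) = lcoord m k 0 x + (\<Sum>i=1..<m. x i)"
    using assms(1) by (simp add: lessThan_atLeast0 sum.atLeast_Suc_lessThan lcoord_def)
  also have "\<dots> = (\<Sum>i<m. x i) + (\<Sum>i=m..<k. x i)"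
    using assms(1) by (simp add: lessThan_atLeast0 sum.atLeast_Suc_lessThan lcoord_def ac_simps)
  also have "\<dots> = (\<Sum>i<k. x i)"
    using assms(2) by (simp add: lessThan_atLeast0 sum.atLeastLessThan_concat)
  finally show ?thesis by simp
qed

lemma subgrp_lker: "subgrp (lker m k B :: (nat \<Rightarrow> 'a::{ab_group_add,finite}) set)"
  using subgrp_tuples[of k, where 'a = 'a]
  by (auto simp: subgrp_def lker_def lcoord_add lcoord_uminus lcoord_zero)

lemma lker_subset_tuples: "lker m k B \<subseteq> tuples k"
  by (auto simp: lker_def)

lemma range_axis_subset_lker:
  assumes "i < m" "m \<le> k" "B \<subseteq> {..<m}" "i \<notin> B"
  shows "range (axis i) \<subseteq> lker m k B"
  using assms by (auto simp: lker_def axis_in_tuples lcoord_axis)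

lemma inv_under_sum_lker:
  assumes "0 < m" "m \<le> k"
  shows "inv_under (lker m k {..<m}) (\<lambda>x. g (\<Sum>i<k. x i))"
  unfolding inv_under_def
proof (intro ballI allI)
  fix e x :: "nat \<Rightarrow> 'a" assume "e \<in> lker m k {..<m}"
  hence "(\<Sum>i<k. e i) = 0"
    using assms by (simp add: sum_eq_lcoord lker_def)
  thus "g (\<Sum>i<k. (x + e) i) = g (\<Sum>i<k. x i)" by (simp add: sum.distrib)
qed

text \<open>\<open>lker m k (D - {i})\<close> is generated by \<open>lker m k D\<close> and the axis
  \<open>i\<close>: cancelling the \<open>i\<close>-th coordinate along that axis lands in
  \<open>lker m k D\<close>.\<close>

lemma inv_under_lker_Diff:
  fixes u :: "(nat \<Rightarrow> 'a::ab_group_add) \<Rightarrow> real"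
  assumes "inv_under (lker m k D \<union> range (axis i)) u" "D \<subseteq> {..<m}" "i \<in> D" "m \<le> k"
  shows "inv_under (lker m k (D - {i})) u"
  unfolding inv_under_def
proof (intro ballI allI)
  fix e x :: "nat \<Rightarrow> 'a" assume e: "e \<in> lker m k (D - {i})"
  define a where "a = axis i (- lcoord m k i e)"
  have i: "i < m" using assms by auto
  have "lcoord m k j (e + a) = 0" if "j \<in> D" for j
    using that e i assms(2) by (auto simp: lcoord_add a_def lcoord_axis lker_def)
  moreover have "e + a \<in> tuples k"
    using e i assms(4) axis_in_tuples[of i k "- lcoord m k i e"]
    by (auto simp: lker_def a_def tuples_def)
  ultimately have "u (x + (e + a)) = u x"
    using assms(1) by (simp add: inv_under_def lker_def)
  moreover have "u (x + e + a) = u (x + e)"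
    using assms(1) by (simp add: inv_under_def a_def)
  ultimately show "u (x + e) = u x" by (simp add: add.assoc)
qed

text \<open>A factor from the box expansion over \<open>D\<close> misses one index \<open>i\<close>
  of \<open>D\<close>, so it sees only the \<open>d\<close> coordinates in
  \<open>D - {i}\<close>.\<close>

lemma unit_prod_dsets:
  assumes U: "unit_prod D (\<lambda>i. lker m k D \<union> range (axis i)) U"
    and D: "D \<subseteq> {..<m}" "card D = Suc d" and "m \<le> k"
  shows "unit_prod (dsets m d) (lker m k) (U :: (nat \<Rightarrow> 'a::{ab_group_add,finite}) \<Rightarrow> real)"
proof -
  have fin: "finite D" using D(1) finite_subset by blast
  obtain u where u: "\<forall>i\<in>D. (\<forall>x. \<bar>u i x\<bar> \<le> 1) \<and> inv_under (lker m k D \<union> range (axis i)) (u i)"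
      "U = (\<lambda>x. \<Prod>i\<in>D. u i x)"
    using U unfolding unit_prod_def by blast
  have "unit_prod D (\<lambda>i. lker m k (D - {i})) U"
  proof (rule unit_prodI[where u = u])
    show "inv_under (lker m k (D - {i})) (u i)" if "i \<in> D" for i
      using u(1) D \<open>m \<le> k\<close> that by (intro inv_under_lker_Diff) auto
  qed (use u in auto)
  thus ?thesis
  proof (rule unit_prod_transfer[OF fin finite_dsets])
    fix i assume "i \<in> D"
    hence "D - {i} \<in> dsets m d" using D fin by (auto simp: dsets_def)
    thus "\<exists>B\<in>dsets m d. lker m k B \<subseteq> (lker m k (D - {i}) :: (nat \<Rightarrow> 'a) set)" by blast
  qed
qed

lemma box_axis_le_correlation:
  fixes F :: "(nat \<Rightarrow> 'a::{ab_group_add,finite}) \<Rightarrow> real"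
  assumes "distinct is" "set is = D" "D \<subseteq> {..<m}" "card D = Suc d" "m \<le> k"
    and "\<And>x. \<bar>F x\<bar> \<le> 1" "inv_under (lker m k D) F"
  shows "\<exists>U. unit_prod (dsets m d) (lker m k) U \<and>
      box (tuples k) axis is F \<le> avg (tuples k) (\<lambda>x. F x * U x)"
proof -
  have "\<exists>U. unit_prod (set is) (\<lambda>i. lker m k D \<union> range (axis i)) U \<and>
      box (tuples k) axis is F \<le> avg (tuples k) (\<lambda>x. F x * U x)"
  proof (rule box_le_correlation[where p = "lcoord m k"])
    show "lcoord m k i (x + axis i a) = lcoord m k i x + a" if "i \<in> set is" for i a and x :: "nat \<Rightarrow> 'a"
      using that assms(2,3) lcoord_axis[of i m i k a] by (auto simp: lcoord_add)
    show "lcoord m k i (x + axis j a) = lcoord m k i x"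
      if "i \<in> set is" "j \<in> set is" "i \<noteq> j" for i j a and x :: "nat \<Rightarrow> 'a"
    proof -
      have "i < m" "j < m" using that assms(2,3) by auto
      thus ?thesis using that lcoord_axis[of i m j k a] by (simp add: lcoord_add)
    qed
    show "lcoord m k i (x + e) = lcoord m k i x"
      if "i \<in> set is" "e \<in> lker m k D" for i e and x :: "nat \<Rightarrow> 'a"
      using that assms(2) by (simp add: lcoord_add lker_def)
  qed (use assms in \<open>auto simp: subgrp_tuples axis_add\<close>)
  thus ?thesis using unit_prod_dsets assms by blast
qed


section \<open>Increasing the number of coordinates\<close>

lemma power_power_two: "(x ^ (2 ^ a)) ^ (2 ^ b) = (x :: real) ^ (2 ^ (a + b))"
  by (simp add: power_add power_mult)

text \<open>At level \<open>Suc m\<close> the factor \<open>v\<close> lives on the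
  \<open>d + 1\<close> coordinates in \<open>D\<close>. \<open>remove_factor\<close> applies with
  \<open>L = lker m k (insert 0 C)\<close> and \<open>K = lker (Suc m) k D\<close>, once every
  factor of \<open>R\<close> is seen to ignore a direction with index in \<open>D\<close>.\<close>

lemma remove_merged_factor:
  fixes g :: "'a::{ab_group_add,finite} \<Rightarrow> real"
  assumes d: "1 \<le> d" and m: "Suc d \<le> m" "m < k" and g: "\<And>x. \<bar>g x\<bar> \<le> 1"
    and C: "C \<subseteq> {1..<m}" "card C = d - 1" "C \<notin> \<C>" and \<C>: "\<C> \<subseteq> {C. C \<subseteq> {1..<m} \<and> card C = d - 1}"
    and v: "\<And>x. \<bar>v x\<bar> \<le> 1" "inv_under (lker m k (insert 0 C)) v"
    and V: "unit_prod \<C> (\<lambda>C. lker m k (insert 0 C)) V"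
    and U: "unit_prod (dsets (Suc m) d) (lker (Suc m) k) U"
  defines "R \<equiv> \<lambda>x. g (\<Sum>i<k. x i) * V x * U x"
  shows "\<exists>W. unit_prod (dsets (Suc m) d) (lker (Suc m) k) W \<and>
      (avg (tuples k) (\<lambda>x. v x * R x)) ^ (2 ^ (d + 2)) \<le> avg (tuples k) (\<lambda>x. R x * W x)"
proof -
  have fC: "finite C" using C(1) finite_subset by blast
  have C_nz: "0 \<notin> C" "m \<notin> C" using C(1) by auto
  \<comment> \<open>There is room for an auxiliary coordinate \<open>y\<close> because
    \<open>card C = d - 1 < m - 1\<close>.\<close>
  have "card C < card {1..<m}" using C d m by simp
  hence "\<not> {1..<m} \<subseteq> C" using fC card_mono leD by blast
  then obtain y where y: "y \<in> {1..<m}" "y \<notin> C" by blast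
  define D where "D = insert 0 (insert m C)"
  have D: "finite D" "D \<subseteq> {..<Suc m}" "card D = Suc d"
    using C_nz fC C d m by (auto simp: D_def)
  define "is" where "is = sorted_list_of_set D"
  have "is": "distinct is" "set is = D" "length is = Suc d"
    using D by (auto simp: is_def)
  txt \<open>Moving \<open>x\<^sub>0\<close> and \<open>x\<^sub>y\<close> in opposite directions leaves the coordinate sum unchanged, so that
    the factor \<open>g\<close> is invariant in the direction of index \<open>0\<close>.\<close>
  define \<iota> :: "nat \<Rightarrow> 'a \<Rightarrow> nat \<Rightarrow> 'a"
    where "\<iota> = (\<lambda>i a. if i = 0 then axis 0 a + axis y (- a) else axis i a)"
  have C_card_less: "\<exists>c\<in>C. c \<notin> B" if "card (B \<inter> C) < d - 1" for B
    using that C(2) by (metis Int_absorb1 less_irrefl subsetI)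
  have ax: "axis i a \<in> lker m' k B" if "i < m'" "m' \<le> k" "B \<subseteq> {..<m'}" "i \<notin> B" for i m' B and a :: 'a
    using range_axis_subset_lker[OF that] by auto
  have gR: "unit_prod (set is) (\<lambda>i. range (\<iota> i)) (\<lambda>x. g (\<Sum>i<k. x i))"
  proof (rule unit_prod_single[of _ 0])
    have "(\<Sum>i<k. \<iota> 0 a i) = 0" for a
      using y m by (simp add: \<iota>_def sum.distrib axis_def)
    thus "inv_under (range (\<iota> 0)) (\<lambda>x. g (\<Sum>i<k. x i))"
      by (auto simp: inv_under_def sum.distrib)
  qed (use "is" g fC in \<open>auto simp: D_def\<close>)
  \<comment> \<open>Another set \<open>C'\<close> of the same size misses some \<open>c\<close> in
    \<open>C\<close>. Direction \<open>m\<close> would not do, as these factors see the merged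
    coordinate.\<close>
  have VR: "unit_prod (set is) (\<lambda>i. range (\<iota> i)) V"
  proof (rule unit_prod_transfer[OF _ _ V])
    show "finite \<C>" using \<C> by (rule finite_subset) simp
    fix C' assume C': "C' \<in> \<C>"
    hence "card C' = card C" "C' \<noteq> C" "C' \<subseteq> {1..<m}" using C \<C> by auto
    hence "\<not> C \<subseteq> C'" using card_subset_eq[of C' C] finite_subset by auto
    then obtain c where c: "c \<in> C" "c \<notin> C'" by blast
    have "c \<noteq> 0" "c < m" using c C by auto
    hence "range (\<iota> c) \<subseteq> lker m k (insert 0 C')"
      using c m \<open>C' \<subseteq> {1..<m}\<close> by (auto simp: \<iota>_def intro!: ax)
    thus "\<exists>j\<in>set is. range (\<iota> j) \<subseteq> lker m k (insert 0 C')"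
      using c "is" by (auto simp: D_def)
  qed simp
  \<comment> \<open>If \<open>y\<close> is not in \<open>B\<close>, any index of \<open>D\<close>
    outside \<open>B\<close> works, even \<open>0\<close>, whose direction moves only
    \<open>x 0\<close> and \<open>x y\<close>. If \<open>y\<close> is in \<open>B\<close>, then
    either \<open>m\<close> is outside \<open>B\<close>, or \<open>y\<close> and \<open>m\<close>
    leave at most \<open>d - 2\<close> elements of \<open>B\<close> for \<open>C\<close>.\<close>
  have UR: "unit_prod (set is) (\<lambda>i. range (\<iota> i)) U"
  proof (rule unit_prod_transfer[OF finite_dsets _ U])
    fix B assume "B \<in> dsets (Suc m) d"
    hence B: "B \<subseteq> {..<Suc m}" "card B = d" "finite B" 
      by (auto simp: dsets_def intro: finite_subset)
    have nz: "range (\<iota> i) \<subseteq> lker (Suc m) k B" if "i \<in> D" "i \<noteq> 0" "i \<notin> B" for i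
      using that D m B by (auto simp: \<iota>_def intro!: ax)
    have "\<exists>j\<in>D. range (\<iota> j) \<subseteq> lker (Suc m) k B"
    proof (cases "y \<in> B")
      case False
      have "\<not> D \<subseteq> B" using card_mono[of B D] B D by auto
      then obtain i where i: "i \<in> D" "i \<notin> B" by blast
      show ?thesis
      proof (cases "i = 0")
        case True
        have "\<iota> 0 a \<in> lker (Suc m) k B" for a
        proof -
          have "axis 0 a \<in> lker (Suc m) k B" "axis y (- a) \<in> lker (Suc m) k B"
            using True i False y m B by (auto intro!: ax)
          thus ?thesis using subgrp_lker[of "Suc m" k B, where 'a = 'a]
            by (simp add: \<iota>_def subgrp_def)
        qed
        thus ?thesis using i True by blast
      qed (use nz i in blast)
    next
      case True
      show ?thesis
      proof (cases "m \<in> B")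
        case False
        thus ?thesis using nz[of m] m by (auto simp: D_def)
      next
        case mB: True
        have "insert y (insert m (B \<inter> C)) \<subseteq> B" using True mB by auto
        hence "card (insert y (insert m (B \<inter> C))) \<le> d" using B card_mono by metis
        moreover have "card (insert y (insert m (B \<inter> C))) = Suc (Suc (card (B \<inter> C)))"
          using y C_nz fC by auto
        ultimately have "card (B \<inter> C) < d - 1" by linarith
        then obtain c where "c \<in> C" "c \<notin> B" using C_card_less[of B] by auto
        thus ?thesis using nz[of c] C_nz by (auto simp: D_def)
      qed
    qed
    thus "\<exists>j\<in>set is. range (\<iota> j) \<subseteq> lker (Suc m) k B" using "is" by simp
  qed simp
  have "\<exists>W. unit_prod (set is) (\<lambda>i. lker (Suc m) k D \<union> range (axis i)) W \<and>
      (avg (tuples k) (\<lambda>x. v x * R x)) ^ (2 ^ Suc (length is)) \<le> avg (tuples k) (\<lambda>x. R x * W x)"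
  proof (rule remove_factor[where p = "lcoord (Suc m) k" and \<iota> = \<iota>])
    show "unit_prod (set is) (\<lambda>i. range (\<iota> i)) R"
      unfolding R_def by (intro unit_prod_mult gR VR UR)
    \<comment> \<open>\<open>K\<close> makes the coordinates \<open>0\<close> and \<open>m\<close>
      vanish separately, while \<open>L\<close> constrains only their sum.\<close>
    show "(lker (Suc m) k D :: (nat \<Rightarrow> 'a) set) \<subseteq> lker m k (insert 0 C)"
    proof
      fix e :: "nat \<Rightarrow> 'a" assume e: "e \<in> lker (Suc m) k D"
      have "lcoord m k 0 e = 0"
        using e m lcoord_Suc(1)[OF m(2), of e] by (simp add: lker_def D_def)
      moreover have "lcoord m k i e = 0" if "i \<in> C" for i
        using e that C_nz lcoord_Suc(2)[OF m(2), of i e] by (auto simp: lker_def D_def)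
      ultimately show "e \<in> lker m k (insert 0 C)" using e by (auto simp: lker_def)
    qed
    show "\<iota> i a \<in> tuples k" if "i \<in> set is" for i a
      using that "is" D m y axis_in_tuples[of i k a] axis_in_tuples[of y k "- a"]
      by (auto simp: \<iota>_def tuples_def)
    show "\<iota> i (a + b) = \<iota> i a + \<iota> i b" if "i \<in> set is" for i a b
      using axis_add[of y "-a" "-b"] by (simp add: \<iota>_def axis_add ac_simps)
    show "\<iota> i a - axis i a \<in> lker m k (insert 0 C)" if "i \<in> set is" for i a
    proof -
      have "insert 0 C \<subseteq> {..<m}" "y \<notin> insert 0 C" "y < m" "m \<le> k" using C y m by auto
      hence "axis y (- a) \<in> lker m k (insert 0 C)" by (intro ax)
      thus ?thesis using subgrp_lker[of m k "insert 0 C", where 'a = 'a]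
        by (auto simp: \<iota>_def subgrp_def)
    qed
    show "lcoord (Suc m) k i (x + axis i a) = lcoord (Suc m) k i x + a"
      if "i \<in> set is" for i a and x :: "nat \<Rightarrow> 'a"
    proof -
      have "i < Suc m" using that "is" D by auto
      thus ?thesis using lcoord_axis[of i "Suc m" i k a] by (simp add: lcoord_add)
    qed
    show "lcoord (Suc m) k i (x + axis j a) = lcoord (Suc m) k i x"
      if "i \<in> set is" "j \<in> set is" "i \<noteq> j" for i j a and x :: "nat \<Rightarrow> 'a"
    proof -
      have "i < Suc m" "j < Suc m" using that "is" D by auto
      thus ?thesis using that lcoord_axis[of i "Suc m" j k a] by (simp add: lcoord_add)
    qed
    show "lcoord (Suc m) k i (x + e) = lcoord (Suc m) k i x"
      if "i \<in> set is" "e \<in> lker (Suc m) k D" for i e and x :: "nat \<Rightarrow> 'a"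
      using that "is" by (simp add: lcoord_add lker_def)
  qed (use v "is" in \<open>auto simp: subgrp_tuples subgrp_lker lker_subset_tuples axis_add\<close>)
  thus ?thesis
    using unit_prod_dsets[of D "Suc m" k _ d] D m "is" by auto
qed

text \<open>Each removal costs the exponent \<open>2 ^ (d + 2)\<close>. The new \<open>W\<close> is
  a product over the same \<open>d\<close>-sets as \<open>U\<close> and is absorbed into it, so only
  the merged factors decrease in number.\<close>

lemma remove_merged_factors:
  fixes g :: "'a::{ab_group_add,finite} \<Rightarrow> real"
  assumes d: "1 \<le> d" and m: "Suc d \<le> m" "m < k" and g: "\<And>x. \<bar>g x\<bar> \<le> 1"
    and \<C>: "finite \<C>" "\<C> \<subseteq> {C. C \<subseteq> {1..<m} \<and> card C = d - 1}"
    and V: "unit_prod \<C> (\<lambda>C. lker m k (insert 0 C)) V"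
    and U: "unit_prod (dsets (Suc m) d) (lker (Suc m) k) U"
    and \<eta>: "0 \<le> \<eta>" "\<eta> \<le> avg (tuples k) (\<lambda>x. g (\<Sum>i<k. x i) * V x * U x)"
  shows "\<exists>W. unit_prod (dsets (Suc m) d) (lker (Suc m) k) W \<and>
      \<eta> ^ (2 ^ ((d + 2) * card \<C>)) \<le> avg (tuples k) (\<lambda>x. g (\<Sum>i<k. x i) * W x)"
  using \<C> V U \<eta>
proof (induction \<C> arbitrary: V U \<eta> rule: finite_induct)
  case empty
  have "V x = 1" for x using empty.prems(2) by (simp add: unit_prod_def)
  thus ?case using empty.prems by auto
next
  case (insert C \<C>)
  obtain v V' where vV: "\<And>x. \<bar>v x\<bar> \<le> 1" "inv_under (lker m k (insert 0 C)) v"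
    "unit_prod \<C> (\<lambda>C. lker m k (insert 0 C)) V'" "V = (\<lambda>x. v x * V' x)"
    using unit_prod_insertE[OF insert.prems(2) insert.hyps] by blast
  define R where "R = (\<lambda>x. g (\<Sum>i<k. x i) * V' x * U x)"
  obtain W where W: "unit_prod (dsets (Suc m) d) (lker (Suc m) k) W"
    "(avg (tuples k) (\<lambda>x. v x * R x)) ^ (2 ^ (d + 2)) \<le> avg (tuples k) (\<lambda>x. R x * W x)"
    using remove_merged_factor[where g = g and C = C and \<C> = \<C> and v = v and V = V' and U = U,
        OF d m g] insert vV unfolding R_def by auto
  have "\<eta> \<le> avg (tuples k) (\<lambda>x. v x * R x)"
    using insert.prems(5) by (simp add: vV(4) R_def ac_simps)
  hence "\<eta> ^ (2 ^ (d + 2)) \<le> (avg (tuples k) (\<lambda>x. v x * R x)) ^ (2 ^ (d + 2))"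
    using insert.prems(4) by (intro power_mono)
  also note W(2)
  finally have "\<eta> ^ (2 ^ (d + 2)) \<le> avg (tuples k) (\<lambda>x. g (\<Sum>i<k. x i) * V' x * (U x * W x))"
    by (simp add: R_def ac_simps)
  moreover have "unit_prod (dsets (Suc m) d) (lker (Suc m) k) (\<lambda>x. U x * W x)"
    by (rule unit_prod_mult[OF insert.prems(3) W(1)])
  ultimately obtain W' where "unit_prod (dsets (Suc m) d) (lker (Suc m) k) W'"
    "(\<eta> ^ (2 ^ (d + 2))) ^ (2 ^ ((d + 2) * card \<C>)) \<le> avg (tuples k) (\<lambda>x. g (\<Sum>i<k. x i) * W' x)"
    using insert.IH[of V' "\<lambda>x. U x * W x" "\<eta> ^ (2 ^ (d + 2))"] insert.prems vV(3) by auto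
  moreover have "(\<eta> ^ (2 ^ (d + 2))) ^ (2 ^ ((d + 2) * card \<C>)) = \<eta> ^ (2 ^ ((d + 2) * card (insert C \<C>)))"
    using insert.hyps unfolding power_power_two by (simp add: algebra_simps)
  ultimately show ?case by metis
qed

text \<open>The \<open>d\<close>-sets without \<open>0\<close> involve no merged coordinate and
  survive at level \<open>Suc m\<close>. Those with \<open>0\<close> are indexed by
  \<open>C = B - {0}\<close> and removed; there are at most \<open>2 ^ m\<close> of them.\<close>

lemma correlation_Suc:
  fixes g :: "'a::{ab_group_add,finite} \<Rightarrow> real"
  assumes d: "1 \<le> d" and m: "Suc d \<le> m" "m < k" and g: "\<And>x. \<bar>g x\<bar> \<le> 1"
    and U: "unit_prod (dsets m d) (lker m k) U"
    and \<eta>: "0 \<le> \<eta>" "\<eta> \<le> 1" "\<eta> \<le> avg (tuples k) (\<lambda>x. g (\<Sum>i<k. x i) * U x)"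
  shows "\<exists>W. unit_prod (dsets (Suc m) d) (lker (Suc m) k) W \<and>
      \<eta> ^ (2 ^ ((d + 2) * 2 ^ m)) \<le> avg (tuples k) (\<lambda>x. g (\<Sum>i<k. x i) * W x)"
proof -
  define I where "I = {B \<in> dsets m d. 0 \<in> B}"
  define J where "J = {B \<in> dsets m d. 0 \<notin> B}"
  have IJ: "finite I" "finite J" "I \<inter> J = {}" "dsets m d = I \<union> J"
    by (auto simp: I_def J_def finite_dsets)
  obtain V0 W0 where VW: "unit_prod I (lker m k) V0" "unit_prod J (lker m k) W0" "U = (\<lambda>x. V0 x * W0 x)"
    using unit_prod_Un[of I J "lker m k" U] U IJ by metis
  define \<C> where "\<C> = {C. C \<subseteq> {1..<m} \<and> card C = d - 1}"
  have fin: "finite \<C>" by (simp add: \<C>_def)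
  have "card \<C> \<le> card (Pow {1..<m})" by (rule card_mono) (auto simp: \<C>_def)
  also have "\<dots> \<le> 2 ^ m" by (simp add: card_Pow)
  finally have card: "card \<C> \<le> 2 ^ m" .
  have "unit_prod \<C> (\<lambda>C. lker m k (insert 0 C)) V0"
  proof (rule unit_prod_transfer[OF IJ(1) fin VW(1)])
    fix B assume B: "B \<in> I"
    hence "B - {0} \<in> \<C>" "insert 0 (B - {0}) = B"
      by (auto simp: I_def \<C>_def dsets_def Suc_leI)
    thus "\<exists>C\<in>\<C>. lker m k (insert 0 C) \<subseteq> lker m k B" by (metis order_refl)
  qed
  moreover have "unit_prod (dsets (Suc m) d) (lker (Suc m) k) W0"
  proof (rule unit_prod_transfer[OF IJ(2) finite_dsets VW(2)])
    fix B assume B: "B \<in> J"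
    hence "B \<in> dsets (Suc m) d" by (auto simp: J_def dsets_def)
    moreover have "lcoord (Suc m) k i e = lcoord m k i e" if "i \<in> B" for i and e :: "nat \<Rightarrow> 'a"
      using that B lcoord_Suc(2)[OF m(2), of i e] by (auto simp: J_def)
    hence "(lker (Suc m) k B :: (nat \<Rightarrow> 'a) set) \<subseteq> lker m k B"
      by (auto simp: lker_def)
    ultimately show "\<exists>B'\<in>dsets (Suc m) d. (lker (Suc m) k B' :: (nat \<Rightarrow> 'a) set) \<subseteq> lker m k B" 
      by blast
  qed
  ultimately obtain W where W: "unit_prod (dsets (Suc m) d) (lker (Suc m) k) W"
    "\<eta> ^ (2 ^ ((d + 2) * card \<C>)) \<le> avg (tuples k) (\<lambda>x. g (\<Sum>i<k. x i) * W x)"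
    using remove_merged_factors[where g = g and V = V0 and U = W0, OF d m g fin _ _ _ \<eta>(1)] \<eta>(3)
    by (auto simp: VW(3) \<C>_def mult.assoc)
  have "\<eta> ^ (2 ^ ((d + 2) * 2 ^ m)) \<le> \<eta> ^ (2 ^ ((d + 2) * card \<C>))"
    using \<eta>(1,2) card by (intro power_decreasing power_increasing mult_left_mono) auto
  with W show ?thesis by (meson order_trans)
qed

text \<open>At \<open>m = Suc d\<close> the correlation comes from expanding the box average; at
  \<open>m = k\<close> the linear coordinates are the actual ones, as the cut norm requires.\<close>

lemma correlation_ladder:
  fixes g :: "'a::{ab_group_add,finite} \<Rightarrow> real"
  assumes d: "1 \<le> d" and g: "\<And>x. \<bar>g x\<bar> \<le> 1" and \<nu>: "0 \<le> \<nu>" "\<nu> \<le> 1" and k: "Suc d \<le> k"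
    and box: "\<nu> ^ (2 ^ Suc d) \<le> box (tuples k) axis [0..<Suc d] (\<lambda>x. g (\<Sum>i<k. x i))"
  shows "Suc d \<le> m \<Longrightarrow> m \<le> k \<Longrightarrow> \<exists>U. unit_prod (dsets m d) (lker m k) U \<and>
      \<nu> ^ (2 ^ ((d + 2) * 2 ^ m)) \<le> avg (tuples k) (\<lambda>x. g (\<Sum>i<k. x i) * U x)"
proof (induction m rule: dec_induct)
  case base
  have "\<exists>U. unit_prod (dsets (Suc d) d) (lker (Suc d) k) U \<and>
      box (tuples k) axis [0..<Suc d] (\<lambda>x. g (\<Sum>i<k. x i)) \<le> avg (tuples k) (\<lambda>x. g (\<Sum>i<k. x i) * U x)"
    by (rule box_axis_le_correlation[where D = "{..<Suc d}"])
      (use k g in \<open>auto intro!: inv_under_sum_lker\<close>)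
  moreover have "\<nu> ^ (2 ^ ((d + 2) * 2 ^ Suc d)) \<le> \<nu> ^ (2 ^ Suc d)"
  proof (rule power_decreasing)
    have "Suc d * 1 \<le> (d + 2) * 2 ^ Suc d" by (intro mult_mono) auto
    thus "2 ^ Suc d \<le> (2 ^ ((d + 2) * 2 ^ Suc d) :: nat)" by (intro power_increasing) auto
  qed (use \<nu> in auto)
  ultimately show ?case using box by (meson order_trans)
next
  case (step m)
  define \<eta> where "\<eta> = \<nu> ^ (2 ^ ((d + 2) * 2 ^ m))"
  obtain U where U: "unit_prod (dsets m d) (lker m k) U"
      "\<eta> \<le> avg (tuples k) (\<lambda>x. g (\<Sum>i<k. x i) * U x)"
    using step unfolding \<eta>_def by auto
  have "0 \<le> \<eta>" "\<eta> \<le> 1" using \<nu> by (auto simp: \<eta>_def power_le_one)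
  then obtain W where W: "unit_prod (dsets (Suc m) d) (lker (Suc m) k) W"
      "\<eta> ^ (2 ^ ((d + 2) * 2 ^ m)) \<le> avg (tuples k) (\<lambda>x. g (\<Sum>i<k. x i) * W x)"
    using correlation_Suc[where g = g and \<eta> = \<eta>, OF d _ _ g U(1)] U(2) step by auto
  \<comment> \<open>The loss at level \<open>m\<close> hits a quantity already carrying the same
    exponent, so the logarithm of the exponent doubles.\<close>
  have "(d + 2) * 2 ^ m + (d + 2) * 2 ^ m = (d + 2) * 2 ^ Suc m" by simp
  hence "\<eta> ^ (2 ^ ((d + 2) * 2 ^ m)) = \<nu> ^ (2 ^ ((d + 2) * 2 ^ Suc m))"
    unfolding \<eta>_def power_power_two by (simp only:)
  with W show ?case by auto
qed

section \<open>The Gowers norm as a box average\<close>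

text \<open>The expression under the root in \<open>gowers_norm\<close>, for which the recursion
  needs no roots.\<close>

definition gowers_avg :: "nat \<Rightarrow> ('a::{ab_group_add,finite} \<Rightarrow> real) \<Rightarrow> real" where
  "gowers_avg n f = avg UNIV (\<lambda>x. avg (PiE {..<n} (\<lambda>_. UNIV))
     (\<lambda>h. \<Prod>S\<in>Pow {..<n}. f (x + (\<Sum>i\<in>S. h i))))"

lemma avg_PiE_Suc:
  fixes F :: "(nat \<Rightarrow> 'a::finite) \<Rightarrow> real"
  shows "avg (PiE {..<Suc n} (\<lambda>_. UNIV)) F =
    avg UNIV (\<lambda>a. avg (PiE {..<n} (\<lambda>_. UNIV)) (\<lambda>h. F (h(n := a))))"
proof -
  let ?P = "PiE {..<n} (\<lambda>_. UNIV :: 'a set)"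
  have inj: "inj_on (\<lambda>(a, h). h(n := a)) (UNIV \<times> ?P)"
    using inj_combinator[of n "{..<n}" "\<lambda>_. UNIV :: 'a set"] by simp
  have eq: "PiE {..<Suc n} (\<lambda>_. UNIV :: 'a set) = (\<lambda>(a, h). h(n := a)) ` (UNIV \<times> ?P)"
    unfolding lessThan_Suc by (rule PiE_insert_eq)
  have "avg (PiE {..<Suc n} (\<lambda>_. UNIV)) F = avg (UNIV \<times> ?P) (\<lambda>z. F ((\<lambda>(a, h). h(n := a)) z))"
    by (rule avg_reindex) (simp add: bij_betw_def inj eq)
  also have "\<dots> = avg UNIV (\<lambda>a. avg ?P (\<lambda>h. F (h(n := a))))"
    by (simp add: avg_def sum.cartesian_product case_prod_unfold card_cartesian_product
        flip: sum_divide_distrib)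
  finally show ?thesis .
qed

text \<open>Each vertex \<open>S\<close> of the cube is paired with \<open>insert n S\<close>, whose
  argument differs by \<open>a\<close>.\<close>

lemma gowers_avg_Suc: "gowers_avg (Suc n) f = avg UNIV (\<lambda>a. gowers_avg n (\<lambda>x. f x * f (x + a)))"
proof -
  have "(\<Prod>S\<in>Pow {..<Suc n}. f (x + (\<Sum>i\<in>S. (h(n := a)) i)))
      = (\<Prod>S\<in>Pow {..<n}. f (x + (\<Sum>i\<in>S. h i)) * f (x + (\<Sum>i\<in>S. h i) + a))" for x a h
  proof -
    have inj: "inj_on (insert n) (Pow {..<n})"
      by (auto simp: inj_on_def)
    have disj: "Pow {..<n} \<inter> insert n ` Pow {..<n} = {}" by auto
    have old: "(\<Sum>i\<in>S. (h(n := a)) i) = (\<Sum>i\<in>S. h i)" if "S \<in> Pow {..<n}" for S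
      using that by (intro sum.cong) auto
    have new: "(\<Sum>i\<in>insert n S. (h(n := a)) i) = (\<Sum>i\<in>S. h i) + a" if "S \<in> Pow {..<n}" for S
    proof -
      have "finite S" "n \<notin> S" using that finite_subset by auto
      thus ?thesis using old[OF that] by (simp add: add.commute)
    qed
    let ?f = "\<lambda>S. f (x + (\<Sum>i\<in>S. (h(n := a)) i))"
    have "prod ?f (Pow {..<Suc n}) = prod ?f (Pow {..<n}) * prod ?f (insert n ` Pow {..<n})"
      unfolding lessThan_Suc Pow_insert by (rule prod.union_disjoint[OF _ _ disj]) auto
    also have "\<dots> = (\<Prod>S\<in>Pow {..<n}. ?f S * ?f (insert n S))"
      by (simp add: prod.reindex[OF inj] prod.distrib)
    also have "\<dots> = (\<Prod>S\<in>Pow {..<n}. f (x + (\<Sum>i\<in>S. h i)) * f (x + (\<Sum>i\<in>S. h i) + a))"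
      by (rule prod.cong) (simp_all only: old new add.assoc)
    finally show ?thesis .
  qed
  thus ?thesis
    unfolding gowers_avg_def avg_PiE_Suc by (subst avg_swap) simp
qed

text \<open>A move by \<open>a\<close> along any axis changes the coordinate sum by
  \<open>a\<close>, so only the number of directions matters.\<close>

lemma box_tuples_eq_gowers_avg:
  fixes g :: "'a::{ab_group_add,finite} \<Rightarrow> real"
  assumes "0 < k" "\<forall>i\<in>set is. i < k"
  shows "box (tuples k) axis is (\<lambda>x. g (\<Sum>i<k. x i)) = gowers_avg (length is) g"
  using assms(2)
proof (induction "is" arbitrary: g)
  case Nil
  have sum_axis: "(\<Sum>i<k. (x + axis 0 a) i) = (\<Sum>i<k. x i) + a" for x and a :: 'a
    using \<open>0 < k\<close> by (simp add: sum.distrib axis_def)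
  have shift: "avg UNIV (\<lambda>a. g (c + a)) = avg UNIV g" for c
    using avg_shift[OF subgrp_UNIV, of c g] by (simp add: add.commute)
  have ne: "finite (tuples k :: (nat \<Rightarrow> 'a) set)" "(tuples k :: (nat \<Rightarrow> 'a) set) \<noteq> {}"
    using subgrp_tuples[of k, where 'a = 'a] by (auto simp: subgrp_def)
  \<comment> \<open>An extra average over shifts of \<open>x 0\<close> shows that the coordinate sum
    is uniformly distributed.\<close>
  have "avg (tuples k) (\<lambda>x. g (\<Sum>i<k. x i))
      = avg UNIV (\<lambda>a::'a. avg (tuples k) (\<lambda>x. g (\<Sum>i<k. (x + axis 0 a) i)))"
    using avg_shift[OF subgrp_tuples axis_in_tuples[OF \<open>0 < k\<close>], of "\<lambda>x. g (\<Sum>i<k. x i)"]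
    by (simp add: avg_const)
  also have "\<dots> = avg (tuples k) (\<lambda>x. avg UNIV (\<lambda>a. g ((\<Sum>i<k. x i) + a)))"
    by (subst avg_swap) (simp only: sum_axis)
  also have "\<dots> = avg UNIV g"
    by (simp add: shift avg_const[OF ne])
  finally show ?case by (simp add: gowers_avg_def avg_const)
next
  case (Cons i "is")
  have sum_axis: "(\<Sum>j<k. (x + axis i a) j) = (\<Sum>j<k. x j) + a" for x and a :: 'a
    using Cons.prems by (simp add: sum.distrib axis_def)
  show ?case
    using Cons.IH[of "\<lambda>x. g x * g (x + _)"] Cons.prems
    by (simp add: sum_axis gowers_avg_Suc del: plus_fun_apply)
qed


section \<open>The cut norm\<close>

text \<open>With \<open>w\<close> the sums of \<open>W\<close> over the fibres of
  \<open>\<rho>\<close>, the extremal \<open>u\<close> is the sign of \<open>w\<close>, a difference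
  of two indicators; hence the factor \<open>2\<close>.\<close>

lemma abs_avg_sign_split:
  fixes W :: "'b \<Rightarrow> real"
  assumes X: "finite X" and u: "\<And>y. \<bar>u y\<bar> \<le> 1" and "\<rho> ` X \<subseteq> Y"
    and c: "\<And>T. T \<subseteq> Y \<Longrightarrow> \<bar>avg X (\<lambda>x. W x * indicator T (\<rho> x))\<bar> \<le> c"
  shows "\<bar>avg X (\<lambda>x. W x * u (\<rho> x))\<bar> \<le> 2 * c"
proof -
  define w where "w = (\<lambda>y. \<Sum>x\<in>{x\<in>X. \<rho> x = y}. W x)"
  have sum_w: "(\<Sum>x\<in>X. W x * t (\<rho> x)) = (\<Sum>y\<in>\<rho> ` X. w y * t y)" for t
  proof -
    have "(\<Sum>x\<in>X. W x * t (\<rho> x)) = (\<Sum>y\<in>\<rho> ` X. \<Sum>x\<in>{x\<in>X. \<rho> x = y}. W x * t (\<rho> x))"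
      by (rule sum.image_gen[OF X])
    also have "\<dots> = (\<Sum>y\<in>\<rho> ` X. w y * t y)"
      unfolding w_def sum_distrib_right by (intro sum.cong) auto
    finally show ?thesis .
  qed
  define P where "P = {y \<in> \<rho> ` X. 0 \<le> w y}"
  define N where "N = {y \<in> \<rho> ` X. w y < 0}"
  have "\<bar>\<Sum>x\<in>X. W x * u (\<rho> x)\<bar> \<le> (\<Sum>y\<in>\<rho> ` X. \<bar>w y * u y\<bar>)"
    unfolding sum_w by (rule sum_abs)
  also have "\<dots> \<le> (\<Sum>y\<in>\<rho> ` X. w y * (indicator P y - indicator N y))"
  proof (rule sum_mono)
    fix y assume y: "y \<in> \<rho> ` X"
    have "\<bar>w y * u y\<bar> \<le> \<bar>w y\<bar>"
      using u[of y] by (simp add: abs_mult mult_left_le)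
    also have "\<dots> = w y * (indicator P y - indicator N y)"
      using y by (auto simp: P_def N_def indicator_def)
    finally show "\<bar>w y * u y\<bar> \<le> w y * (indicator P y - indicator N y)" .
  qed
  also have "\<dots> = (\<Sum>x\<in>X. W x * (indicator P (\<rho> x) - indicator N (\<rho> x)))"
    by (rule sum_w[symmetric])
  finally have "\<bar>avg X (\<lambda>x. W x * u (\<rho> x))\<bar>
      \<le> avg X (\<lambda>x. W x * indicator P (\<rho> x) - W x * indicator N (\<rho> x))"
    unfolding avg_def by (simp add: divide_right_mono right_diff_distrib)
  also have "\<dots> = avg X (\<lambda>x. W x * indicator P (\<rho> x)) - avg X (\<lambda>x. W x * indicator N (\<rho> x))"
    by (rule avg_diff)
  also have "\<dots> \<le> 2 * c"
    using c[of P] c[of N] assms(3) by (fastforce simp: P_def N_def)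
  finally show ?thesis .
qed

text \<open>\<open>x\<close> and its zero extension from \<open>B\<close> differ by an element of
  \<open>lker k k B\<close>.\<close>

lemma inv_under_lker_eq:
  fixes u :: "(nat \<Rightarrow> 'a::ab_group_add) \<Rightarrow> real"
  assumes "inv_under (lker k k B) u" "x \<in> tuples k"
  shows "u x = u (\<lambda>i. if i \<in> B then restrict x B i else 0)"
proof -
  define e where "e = (\<lambda>i. if i \<in> B then 0 else x i)"
  have "e \<in> lker k k B"
    using assms(2) by (auto simp: e_def lker_def tuples_def lcoord_same)
  moreover have "(\<lambda>i. if i \<in> B then restrict x B i else 0) + e = x"
    by (auto simp: e_def)
  ultimately show ?thesis
    using assms(1) unfolding inv_under_def by metis
qed

text \<open>Bounded factors are traded for indicators one at a time, at a factor \<open>2\<close>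
  each; the induction varies \<open>f\<close> so that it can take in the indicator.\<close>

lemma abs_avg_unit_prod_le:
  fixes f :: "(nat \<Rightarrow> 'a::{ab_group_add,finite}) \<Rightarrow> real"
  assumes "finite \<B>" "unit_prod \<B> (lker k k) U"
    and "\<And>S. (\<And>B. S B \<subseteq> PiE B (\<lambda>_. UNIV)) \<Longrightarrow>
      \<bar>avg (tuples k) (\<lambda>x. f x * (\<Prod>B\<in>\<B>. indicator (S B) (restrict x B)))\<bar> \<le> c"
  shows "\<bar>avg (tuples k) (\<lambda>x. f x * U x)\<bar> \<le> 2 ^ card \<B> * c"
  using assms
proof (induction \<B> arbitrary: f U rule: finite_induct)
  case empty
  have "U x = 1" for x using empty.prems(1) by (simp add: unit_prod_def)
  thus ?case using empty.prems(2)[of "\<lambda>_. {}"] by simp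
next
  case (insert B \<B>)
  obtain u V where uV: "\<And>x. \<bar>u x\<bar> \<le> 1" "inv_under (lker k k B) u" "unit_prod \<B> (lker k k) V"
    "U = (\<lambda>x. u x * V x)"
    using unit_prod_insertE[OF insert.prems(1) insert.hyps] by blast
  have T: "\<bar>avg (tuples k) (\<lambda>x. f x * V x * indicator T (restrict x B))\<bar> \<le> 2 ^ card \<B> * c"
    if T: "T \<subseteq> PiE B (\<lambda>_. UNIV)" for T
  proof -
    have "\<bar>avg (tuples k) (\<lambda>x. (f x * indicator T (restrict x B)) * V x)\<bar> \<le> 2 ^ card \<B> * c"
    proof (rule insert.IH[OF uV(3)])
      fix S :: "nat set \<Rightarrow> (nat \<Rightarrow> 'a) set"
      assume S: "\<And>B. S B \<subseteq> PiE B (\<lambda>_. UNIV)"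
      have "(\<Prod>B'\<in>\<B>. indicator ((S(B := T)) B') (restrict x B'))
          = (\<Prod>B'\<in>\<B>. indicator (S B') (restrict x B') :: real)" for x
        using insert.hyps by (intro prod.cong) auto
      hence "f x * (\<Prod>B'\<in>insert B \<B>. indicator ((S(B := T)) B') (restrict x B'))
          = f x * indicator T (restrict x B) * (\<Prod>B'\<in>\<B>. indicator (S B') (restrict x B'))" for x
        unfolding prod.insert[OF insert.hyps] by simp
      moreover have "(S(B := T)) B' \<subseteq> PiE B' (\<lambda>_. UNIV)" for B'
        using S T by auto
      ultimately show "\<bar>avg (tuples k) (\<lambda>x. f x * indicator T (restrict x B) *
          (\<Prod>B\<in>\<B>. indicator (S B) (restrict x B)))\<bar> \<le> c"
        using insert.prems(2)[of "S(B := T)"] by (simp only:)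
    qed
    thus ?thesis by (simp add: ac_simps)
  qed
  \<comment> \<open>\<open>u\<close> read as a function of the restriction, with \<open>0\<close> in
    place of the \<open>undefined\<close> that \<open>restrict\<close> leaves outside
    \<open>B\<close>.\<close>
  define u' where "u' = (\<lambda>y. u (\<lambda>i. if i \<in> B then y i else 0))"
  have "\<bar>avg (tuples k) (\<lambda>x. f x * V x * u' (restrict x B))\<bar> \<le> 2 * (2 ^ card \<B> * c)"
  proof (rule abs_avg_sign_split[where u = u' and \<rho> = "\<lambda>x. restrict x B" and Y = "PiE B (\<lambda>_. UNIV)"])
    show "finite (tuples k :: (nat \<Rightarrow> 'a) set)"
      using subgrp_tuples[of k, where 'a = 'a] by (simp add: subgrp_def)
  qed (use uV T in \<open>auto simp: u'_def\<close>)
  moreover have "avg (tuples k) (\<lambda>x. f x * U x) = avg (tuples k) (\<lambda>x. f x * V x * u' (restrict x B))"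
  proof (rule avg_cong)
    fix x :: "nat \<Rightarrow> 'a" assume "x \<in> tuples k"
    thus "f x * U x = f x * V x * u' (restrict x B)"
      using inv_under_lker_eq[OF uV(2)] by (simp add: u'_def uV(4))
  qed
  ultimately show ?case using insert.hyps by simp
qed

section \<open>Comparison of the cut norm with the Gowers norm\<close>

lemma cut_norm_tuples:
  fixes g :: "'a::{ab_group_add,finite} \<Rightarrow> real"
  shows "cut_norm k d UNIV (\<lambda>x. g (\<Sum>i<k. x i)) =
    Sup {\<bar>avg (tuples k) (\<lambda>x. g (\<Sum>i<k. x i) *
        (\<Prod>B\<in>dsets k d. indicator (S B) (restrict x B)))\<bar> | S. \<forall>B. S B \<subseteq> PiE B (\<lambda>_. UNIV)}"
proof -
  have "avg (PiE {..<k} (\<lambda>_. UNIV)) (\<lambda>x. g (\<Sum>i<k. x i) *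
        (\<Prod>B\<in>{B. B \<subseteq> {..<k} \<and> card B = d}. indicator (S B) (restrict x B)))
      = avg (tuples k) (\<lambda>x. g (\<Sum>i<k. x i) *
        (\<Prod>B\<in>dsets k d. indicator (S B) (restrict x B)))" for S :: "nat set \<Rightarrow> (nat \<Rightarrow> 'a) set"
  proof -
    have "restrict (restrict x {..<k}) B = restrict x B" if "B \<in> dsets k d" for x :: "nat \<Rightarrow> 'a" and B
      using that by (simp add: dsets_def Int_absorb1)
    thus ?thesis
      unfolding avg_tuples dsets_def[symmetric] by (intro avg_cong) simp
  qed
  thus ?thesis unfolding cut_norm_def by simp
qed

lemma cut_norm_le_gowers_norm:
  fixes g :: "'a::{ab_group_add,finite} \<Rightarrow> real"
  assumes "Suc d \<le> k"
  shows "cut_norm k d UNIV (\<lambda>x. g (\<Sum>i<k. x i)) \<le> gowers_norm (d + 1) g"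
  unfolding cut_norm_tuples
proof (rule cSup_least)
  show "{\<bar>avg (tuples k) (\<lambda>x. g (\<Sum>i<k. x i) * (\<Prod>B\<in>dsets k d. indicator (S B) (restrict x B)))\<bar> | S.
      \<forall>B. S B \<subseteq> PiE B (\<lambda>_. UNIV)} \<noteq> {}"
    by (auto intro: exI[of _ "\<lambda>_. {}"])
next
  fix r assume "r \<in> {\<bar>avg (tuples k) (\<lambda>x. g (\<Sum>i<k. x i) *
      (\<Prod>B\<in>dsets k d. indicator (S B) (restrict x B)))\<bar> | S. \<forall>B. S B \<subseteq> PiE B (\<lambda>_. UNIV)}"
  then obtain S :: "nat set \<Rightarrow> (nat \<Rightarrow> 'a) set" where r: "r = \<bar>avg (tuples k) (\<lambda>x. g (\<Sum>i<k. x i) *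
      (\<Prod>B\<in>dsets k d. indicator (S B) (restrict x B)))\<bar>" by blast
  define U where "U = (\<lambda>x. \<Prod>B\<in>dsets k d. indicator (S B) (restrict x B) :: real)"
  have U: "unit_prod (dsets k d) (lker k k) U"
  proof (rule unit_prodI[where u = "\<lambda>B x. indicator (S B) (restrict x B)"])
    fix B
    have "restrict (x + e) B = restrict x B" if "e \<in> lker k k B" for x e :: "nat \<Rightarrow> 'a"
      using that by (auto simp: lker_def lcoord_same restrict_def fun_eq_iff)
    thus "inv_under (lker k k B) (\<lambda>x. indicator (S B) (restrict x B))"
      by (simp add: inv_under_def)
  qed (auto simp: U_def indicator_def)
  have "unit_prod (set [0..<Suc d]) (\<lambda>i. range (axis i)) U"
  proof (rule unit_prod_transfer[OF finite_dsets _ U])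
    fix B assume "B \<in> dsets k d"
    hence B: "B \<subseteq> {..<k}" "card B = d" "finite B" by (auto simp: dsets_def intro: finite_subset)
    hence "\<not> {..<Suc d} \<subseteq> B" using card_mono[of B "{..<Suc d}"] by auto
    then obtain i where i: "i < Suc d" "i \<notin> B" by blast
    hence "range (axis i) \<subseteq> (lker k k B :: (nat \<Rightarrow> 'a) set)"
      using assms B by (intro range_axis_subset_lker) auto
    thus "\<exists>i\<in>set [0..<Suc d]. range (axis i) \<subseteq> (lker k k B :: (nat \<Rightarrow> 'a) set)"
      using i by (intro bexI[of _ i]) auto
  qed simp
  hence "(avg (tuples k) (\<lambda>x. g (\<Sum>i<k. x i) * U x)) ^ (2 ^ length [0..<Suc d])
      \<le> box (tuples k) axis [0..<Suc d] (\<lambda>x. g (\<Sum>i<k. x i))"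
    using assms by (intro gowers_cauchy_schwarz subgrp_tuples axis_in_tuples axis_add) auto
  also have "\<dots> = gowers_avg (Suc d) g"
    using assms box_tuples_eq_gowers_avg[of k "[0..<Suc d]" g] by auto
  finally have "r ^ (2 ^ Suc d) \<le> gowers_avg (Suc d) g"
    by (simp add: r U_def power_even_abs)
  hence "root (2 ^ Suc d) (r ^ (2 ^ Suc d)) \<le> root (2 ^ Suc d) (gowers_avg (Suc d) g)"
    by (intro real_root_le_mono) auto
  thus "r \<le> gowers_norm (d + 1) g"
    using r by (simp add: gowers_norm_def gowers_avg_def real_root_power_cancel)
qed

text \<open>The supremum dominates its members because the bound on \<open>g\<close> bounds the
  whole set by \<open>1\<close>.\<close>

lemma abs_avg_le_cut_norm:
  fixes g :: "'a::{ab_group_add,finite} \<Rightarrow> real"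
  assumes "\<And>x. \<bar>g x\<bar> \<le> 1" and S: "\<And>B. S B \<subseteq> PiE B (\<lambda>_. UNIV)"
  shows "\<bar>avg (tuples k) (\<lambda>x. g (\<Sum>i<k. x i) * (\<Prod>B\<in>dsets k d. indicator (S B) (restrict x B)))\<bar>
    \<le> cut_norm k d UNIV (\<lambda>x. g (\<Sum>i<k. x i))"
  unfolding cut_norm_tuples
proof (rule cSup_upper)
  have "\<bar>avg (tuples k) (\<lambda>x. g (\<Sum>i<k. x i) * (\<Prod>B\<in>dsets k d. indicator (S B) (restrict x B)))\<bar> \<le> 1"
    for S :: "nat set \<Rightarrow> (nat \<Rightarrow> 'a) set"
  proof (intro abs_avg_le_1 abs_mult_le_1 assms)
    show "\<bar>\<Prod>B\<in>dsets k d. indicator (S B) (restrict x B) :: real\<bar> \<le> 1" for x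
      unfolding abs_prod by (intro prod_le_1) (auto simp: indicator_def)
  qed
  thus "bdd_above {\<bar>avg (tuples k) (\<lambda>x. g (\<Sum>i<k. x i) *
      (\<Prod>B\<in>dsets k d. indicator (S B) (restrict x B)))\<bar> | S. \<forall>B. S B \<subseteq> PiE B (\<lambda>_. UNIV)}"
    by (intro bdd_aboveI[of _ 1]) blast
qed (use S in blast)

text \<open>The ladder at \<open>m = k\<close> gives a product over \<open>dsets k d\<close>;
  trading its at most \<open>2 ^ k\<close> factors for indicators costs
  \<open>2 ^ (2 ^ k)\<close>.\<close>

lemma gowers_norm_power_le_cut_norm:
  fixes g :: "'a::{ab_group_add,finite} \<Rightarrow> real"
  assumes "1 \<le> d" "Suc d \<le> k" and g: "\<And>x. \<bar>g x\<bar> \<le> 1"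
  shows "0 \<le> gowers_norm (d + 1) g" "gowers_norm (d + 1) g \<le> 1"
    "gowers_norm (d + 1) g ^ (2 ^ ((d + 2) * 2 ^ k))
      \<le> 2 ^ (2 ^ k) * cut_norm k d UNIV (\<lambda>x. g (\<Sum>i<k. x i))"
proof -
  let ?F = "\<lambda>x. g (\<Sum>i<k. x i)" and ?\<nu> = "gowers_norm (d + 1) g"
  have box: "box (tuples k) axis [0..<Suc d] ?F = gowers_avg (Suc d) g"
    using assms box_tuples_eq_gowers_avg[of k "[0..<Suc d]" g] by auto
  \<comment> \<open>Gowers--Cauchy--Schwarz with \<open>U = 1\<close> makes the box average
    nonnegative; its expansion, used next, bounds it by \<open>1\<close>.\<close>
  have "(avg (tuples k) (\<lambda>x. ?F x * 1)) ^ (2 ^ length [0..<Suc d]) \<le> gowers_avg (Suc d) g"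
    unfolding box[symmetric] using assms
    by (intro gowers_cauchy_schwarz subgrp_tuples axis_in_tuples axis_add unit_prod_one) auto
  moreover have "0 \<le> (avg (tuples k) (\<lambda>x. ?F x * 1)) ^ (2 ^ length [0..<Suc d])"
    by (simp add: zero_le_even_power)
  ultimately have nonneg: "0 \<le> gowers_avg (Suc d) g" by linarith
  have "\<exists>U. unit_prod (dsets (Suc d) d) (lker (Suc d) k) U \<and>
      box (tuples k) axis [0..<Suc d] ?F \<le> avg (tuples k) (\<lambda>x. ?F x * U x)"
    by (rule box_axis_le_correlation[where D = "{..<Suc d}"])
      (use assms in \<open>auto intro!: inv_under_sum_lker\<close>)
  then obtain U where U: "unit_prod (dsets (Suc d) d) (lker (Suc d) k) U"
      "gowers_avg (Suc d) g \<le> avg (tuples k) (\<lambda>x. ?F x * U x)"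
    unfolding box by blast
  have "\<bar>avg (tuples k) (\<lambda>x. ?F x * U x)\<bar> \<le> 1"
    by (intro abs_avg_le_1 abs_mult_le_1 g unit_prod_abs_le[OF U(1)])
  hence le1: "gowers_avg (Suc d) g \<le> 1" using U(2) by linarith
  have \<nu>: "?\<nu> = root (2 ^ Suc d) (gowers_avg (Suc d) g)"
    by (simp add: gowers_norm_def gowers_avg_def)
  show 0: "0 \<le> ?\<nu>" using nonneg unfolding \<nu> by simp
  show 1: "?\<nu> \<le> 1" using le1 unfolding \<nu> by (subst real_root_le_1_iff) auto
  have "?\<nu> ^ (2 ^ Suc d) = gowers_avg (Suc d) g"
    unfolding \<nu> using nonneg by (intro real_root_pow_pos2) auto
  hence "?\<nu> ^ (2 ^ Suc d) \<le> box (tuples k) axis [0..<Suc d] ?F"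
    using box by simp
  from correlation_ladder[where g = g, OF assms(1) g 0 1 assms(2) this assms(2) order_refl]
  obtain W where W: "unit_prod (dsets k d) (lker k k) W"
    "?\<nu> ^ (2 ^ ((d + 2) * 2 ^ k)) \<le> avg (tuples k) (\<lambda>x. ?F x * W x)" by blast
  let ?c = "cut_norm k d UNIV ?F"
  have "\<bar>avg (tuples k) (\<lambda>x. ?F x * W x)\<bar> \<le> 2 ^ card (dsets k d) * ?c"
    by (rule abs_avg_unit_prod_le[OF finite_dsets W(1)]) (rule abs_avg_le_cut_norm[OF g])
  also have "\<dots> \<le> 2 ^ (2 ^ k) * ?c"
  proof (rule mult_right_mono)
    show "0 \<le> ?c"
      using abs_avg_le_cut_norm[of g "\<lambda>_. {}" k d] g by force
  qed (intro power_increasing card_dsets_le, simp)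
  finally show "?\<nu> ^ (2 ^ ((d + 2) * 2 ^ k)) \<le> 2 ^ (2 ^ k) * ?c"
    using W(2) by linarith
qed

theorem theorem3p1:
  fixes A :: "'a::{ab_group_add,finite} set" and d :: nat and \<epsilon> :: real
  defines "\<delta> \<equiv> real (card A) / real (card (UNIV :: 'a set))"
  assumes "d \<ge> 1" and "0 < \<epsilon>" and "\<epsilon> < 1"
  shows "(gowers_norm (d+1) (\<lambda>x. indicator A x - \<delta>) \<le> \<epsilon> \<longrightarrow>
            (\<forall>k. k \<ge> d+1 \<longrightarrow> cut_norm k d UNIV (\<lambda>x. cayley_graph k A x - \<delta>) \<le> \<epsilon>))
       \<and> (\<forall>k. k \<ge> d+1 \<longrightarrow> cut_norm k d UNIV (\<lambda>x. cayley_graph k A x - \<delta>) \<le> \<epsilon> \<longrightarrow>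
            gowers_norm (d+1) (\<lambda>x. indicator A x - \<delta>)
              \<le> 2 * \<epsilon> powr (2 powr (- (real (d+2) * real (2*d+2)^k))))"
proof (intro conjI impI allI)
  define g where "g = (\<lambda>x. indicator A x - \<delta>)"
  have cayley: "(\<lambda>x. cayley_graph k A x - \<delta>) = (\<lambda>x. g (\<Sum>i<k. x i))" for k
    by (simp add: cayley_graph_def g_def)
  {
    fix k assume "gowers_norm (d + 1) (\<lambda>x. indicator A x - \<delta>) \<le> \<epsilon>" "d + 1 \<le> k"
    thus "cut_norm k d UNIV (\<lambda>x. cayley_graph k A x - \<delta>) \<le> \<epsilon>"
      using cut_norm_le_gowers_norm[of d k g] unfolding cayley by (simp add: g_def)
  }
  fix k assume k: "d + 1 \<le> k" and cut: "cut_norm k d UNIV (\<lambda>x. cayley_graph k A x - \<delta>) \<le> \<epsilon>"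
  have "card A \<le> card (UNIV :: 'a set)" by (simp add: card_mono)
  moreover have "0 < card (UNIV :: 'a set)" by (simp add: card_gt_0_iff)
  ultimately have "0 \<le> \<delta>" "\<delta> \<le> 1" by (auto simp: \<delta>_def divide_le_eq_1)
  hence g: "\<bar>g x\<bar> \<le> 1" for x by (auto simp: g_def indicator_def)
  \<comment> \<open>\<open>1 / 2 ^ e\<close> is the exponent of \<open>\<epsilon>\<close> in part
    (ii). Since \<open>(d + 2) * 2 ^ k \<le> e\<close> and \<open>2 ^ k \<le> 2 ^ e\<close>, the
    bound on \<open>\<nu>\<close> weakens to one on \<open>\<nu> ^ (2 ^ e)\<close>, whose constant
    becomes the leading \<open>2\<close> after taking the root.\<close>
  define e where "e = (d + 2) * (2 * d + 2) ^ k"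
  define \<nu> where "\<nu> = gowers_norm (d + 1) g"
  note \<nu> = gowers_norm_power_le_cut_norm[where g = g and d = d and k = k, folded \<nu>_def]
  have \<nu>01: "0 \<le> \<nu>" "\<nu> \<le> 1" using \<nu>(1,2) assms k g by auto
  have "2 ^ k \<le> (2 * d + 2) ^ k" by (intro power_mono) auto
  hence k_e: "(d + 2) * 2 ^ k \<le> e" unfolding e_def by (rule mult_left_mono) simp
  have "1 * 2 ^ k \<le> (d + 2) * 2 ^ k" by (rule mult_right_mono) auto
  hence k_e': "2 ^ k \<le> e" using k_e by linarith
  hence k_e'': "2 ^ k \<le> (2 ^ e :: nat)" using less_exp[of e] by linarith
  have "\<nu> ^ (2 ^ e) \<le> \<nu> ^ (2 ^ ((d + 2) * 2 ^ k))"
    by (rule power_decreasing[OF power_increasing[OF k_e] \<nu>01]) simp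
  also have "\<dots> \<le> 2 ^ (2 ^ k) * cut_norm k d UNIV (\<lambda>x. g (\<Sum>i<k. x i))"
    using \<nu>(3) assms k g by simp
  also have "\<dots> \<le> 2 ^ (2 ^ k) * \<epsilon>"
    using cut unfolding cayley by simp
  also have "\<dots> \<le> 2 ^ (2 ^ e) * \<epsilon>"
    using k_e'' assms(3) by (intro mult_right_mono power_increasing) auto
  also have "\<dots> = (2 * \<epsilon> powr (1 / 2 ^ e)) ^ (2 ^ e)"
  proof -
    have "(\<epsilon> powr (1 / 2 ^ e)) ^ (2 ^ e) = \<epsilon>"
      using assms(3) by (simp add: powr_realpow[symmetric] powr_powr)
    thus ?thesis by (simp add: power_mult_distrib)
  qed
  finally have "\<nu> \<le> 2 * \<epsilon> powr (1 / 2 ^ e)"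
    using \<nu>01(1) by (subst (asm) power_mono_iff) auto
  moreover have "2 powr (- (real (d + 2) * real (2 * d + 2) ^ k)) = 1 / 2 ^ e"
  proof -
    have "real (d + 2) * real (2 * d + 2) ^ k = real e"
      by (simp only: e_def of_nat_mult of_nat_power)
    thus ?thesis by (simp only: powr_minus_divide powr_realpow zero_less_numeral)
  qed
  ultimately show "gowers_norm (d + 1) (\<lambda>x. indicator A x - \<delta>)
      \<le> 2 * \<epsilon> powr (2 powr (- (real (d + 2) * real (2 * d + 2) ^ k)))"
    by (simp only: \<nu>_def g_def)
qed

end
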